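(* Let $G$ be a prime tournament which is not isomorphic to $T_n$, $U_n$, or $W_n$ for any odd $n$, and let $H$ be a prime subtournament of $G$ with $5 \le |V(H)| \le |V(G)| - 1$. Then there exists a prime subtournament of $G$ with $|V(H)|+1$ vertices that has a subtournament isomorphic to $H$.
   Context: A tournament is a finite, non-null, loopless directed graph in which for any two distinct vertices $u,v$ there is exactly one edge with both ends in $\{u,v\}$; write $u \to v$ if the edge goes from $u$ to $v$. A subtournament is the tournament induced on a nonempty subset of vertices. For disjoint vertex sets $X,Y$, $X \Rightarrow Y$ means $x \to y$ for all $x\in X$, $y \in Y$. A homogeneous set of a tournament $G$ is a set $X \subseteq V(G)$ such that for every $v \in V(G)\setminus X$, either $v \to x$ for all $x \in X$ or $x \to v$ for all $x\in X$; it is nontrivial if $1<|X|<|V(G)|$. A tournament is prime if all its homogeneous sets are trivial. For $k \ge 0$ and $n=2k+1$: $T_n$ is the tournament on $v_1,\dots,v_n$ with $v_i \to v_j$ iff $j \equiv i+1, i+2,\dots, i+k \pmod n$; $U_n$ is obtained from $T_n$ by reversing all edges with both ends in $\{v_1,\dots,v_k\}$; $W_n$ is the tournament on $w_1,\dots,w_n$ with $w_i \to w_j$ for $1 \le i<j\le n-1$ and $\{w_2,w_4,\dots,w_{n-1}\} \Rightarrow w_n \Rightarrow \{w_1,w_3,\dots,w_{n-2}\}$. *)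

theory Defs
  imports Main
begin

text \<open>A tournament is given by a finite nonempty vertex set V and an edge relation E
  (E u v means u -> v); only the values of E on V matter.\<close>
definition tournament :: "'a set \<Rightarrow> ('a \<Rightarrow> 'a \<Rightarrow> bool) \<Rightarrow> bool" where
  "tournament V E \<longleftrightarrow> finite V \<and> V \<noteq> {} \<and> (\<forall>u\<in>V. \<not> E u u) \<and>
     (\<forall>u\<in>V. \<forall>v\<in>V. u \<noteq> v \<longrightarrow> (E u v \<longleftrightarrow> \<not> E v u))"

definition homogeneous :: "'a set \<Rightarrow> ('a \<Rightarrow> 'a \<Rightarrow> bool) \<Rightarrow> 'a set \<Rightarrow> bool" where
  "homogeneous V E X \<longleftrightarrow> X \<subseteq> V \<and>
     (\<forall>v\<in>V - X. (\<forall>x\<in>X. E v x) \<or> (\<forall>x\<in>X. E x v))"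

definition nontrivial_set :: "'a set \<Rightarrow> 'a set \<Rightarrow> bool" where
  "nontrivial_set V X \<longleftrightarrow> 1 < card X \<and> card X < card V"

definition prime_tournament :: "'a set \<Rightarrow> ('a \<Rightarrow> 'a \<Rightarrow> bool) \<Rightarrow> bool" where
  "prime_tournament V E \<longleftrightarrow> tournament V E \<and>
     (\<forall>X. homogeneous V E X \<longrightarrow> \<not> nontrivial_set V X)"

definition tourn_iso :: "'a set \<Rightarrow> ('a \<Rightarrow> 'a \<Rightarrow> bool) \<Rightarrow> 'b set \<Rightarrow> ('b \<Rightarrow> 'b \<Rightarrow> bool) \<Rightarrow> bool" where
  "tourn_iso V E V' E' \<longleftrightarrow> (\<exists>f. bij_betw f V V' \<and> (\<forall>u\<in>V. \<forall>v\<in>V. E u v \<longleftrightarrow> E' (f u) (f v)))"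

text \<open>T_n on vertices {1..n}, n = 2k+1: i -> j iff j = i+1,...,i+k (mod n).\<close>
definition T_edge :: "nat \<Rightarrow> nat \<Rightarrow> nat \<Rightarrow> bool" where
  "T_edge n i j \<longleftrightarrow> (let d = (j + n - i) mod n in 1 \<le> d \<and> d \<le> n div 2)"

definition U_edge :: "nat \<Rightarrow> nat \<Rightarrow> nat \<Rightarrow> bool" where
  "U_edge n i j \<longleftrightarrow> (if i \<le> n div 2 \<and> j \<le> n div 2 then T_edge n j i else T_edge n i j)"

definition W_edge :: "nat \<Rightarrow> nat \<Rightarrow> nat \<Rightarrow> bool" where
  "W_edge n i j \<longleftrightarrow> (if i < n \<and> j < n then i < j
     else if j = n \<and> i < n then even i
     else if i = n \<and> j < n then odd j else False)"

end

(* Call a vertex set a copy if it induces a tournament isomorphic to H, and suppose that no copy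
   has a prime extension by one vertex.  Relative to a copy X, every other vertex is then uniform
   over X or a twin of some c in X, and in the latter case c may be exchanged for it, giving
   another copy.  If X is not all of V, two vertices can be added to X to give a prime K.

   Call {p, q} good if K - {p, q} is a copy.  If {p, q} is good, then either q is uniform over
   K - {p, q}, or q has a unique twin w over K - {p}, and {p, w} is good too.  So the good pairs
   form a graph of maximum degree two.  Along a path p_1, ..., p_m of good pairs, p_(i-1) and
   p_(i+1) are separated by p_i only; hence for a < b the direction between p_a and p_b depends
   only on the parities of a and b, and p_1 -> p_2 -> p_3 -> ... may be assumed.  A maximal path
   closes up to a cycle (then K is some T_k) or has both ends uniform (then K is some U_k, or,
   with one further vertex, some W_k).

   Finally K has no prime extension by a vertex z either: z extends none of the copies obtained
   by deleting a consecutive pair of the path, so after each such deletion the out-neighbours of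
   z, suitably twisted by parity, form a final segment of the path.  This forces the same on
   the whole path, which makes z uniform over K or a twin of a vertex of K.  So K can take the
   place of H, and by induction V itself is T_k, U_k or W_k. *)

theory Submission
  imports Defs
begin

section \<open>Twins and prime extensions\<close>

text \<open>Only arcs into the pair are compared; in a tournament the arcs out of it then agree as
  well. \<open>c\<close> and \<open>z\<close> need not lie in \<open>X\<close>, so this covers pairs
  inside \<open>X\<close> and also a new vertex \<open>z\<close> resembling some \<open>c\<close> of
  \<open>X\<close>.\<close>

definition twins :: "('a \<Rightarrow> 'a \<Rightarrow> bool) \<Rightarrow> 'a set \<Rightarrow> 'a \<Rightarrow> 'a \<Rightarrow> bool" where
  "twins E X c z \<longleftrightarrow> (\<forall>v\<in>X - {c, z}. E v c \<longleftrightarrow> E v z)"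

definition uniform :: "('a \<Rightarrow> 'a \<Rightarrow> bool) \<Rightarrow> 'a set \<Rightarrow> 'a \<Rightarrow> bool" where
  "uniform E X z \<longleftrightarrow> (\<forall>x\<in>X. E z x) \<or> (\<forall>x\<in>X. E x z)"

lemma twinsD: "twins E X c z \<Longrightarrow> v \<in> X \<Longrightarrow> v \<noteq> c \<Longrightarrow> v \<noteq> z \<Longrightarrow> E v c \<longleftrightarrow> E v z"
  unfolding twins_def by blast

lemma twins_subset: "twins E X c z \<Longrightarrow> Y \<subseteq> X \<Longrightarrow> twins E Y c z"
  unfolding twins_def by blast

lemma uniform_subset: "uniform E X z \<Longrightarrow> Y \<subseteq> X \<Longrightarrow> uniform E Y z"
  unfolding uniform_def by blast

lemma tournament_subset: "tournament V E \<Longrightarrow> X \<subseteq> V \<Longrightarrow> X \<noteq> {} \<Longrightarrow> tournament X E"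
  unfolding tournament_def by (meson finite_subset subsetD)

lemma tournamentD: "tournament V E \<Longrightarrow> u \<in> V \<Longrightarrow> v \<in> V \<Longrightarrow> u \<noteq> v \<Longrightarrow> E u v \<longleftrightarrow> \<not> E v u"
  unfolding tournament_def by blast

lemma tournament_irrefl: "tournament V E \<Longrightarrow> u \<in> V \<Longrightarrow> \<not> E u u"
  unfolding tournament_def by blast

lemma tournament_finite: "tournament V E \<Longrightarrow> finite V"
  unfolding tournament_def by blast

lemma prime_tournamentD: "prime_tournament V E \<Longrightarrow> tournament V E"
  unfolding prime_tournament_def by blast

lemma prime_finite: "prime_tournament V E \<Longrightarrow> finite V"
  using prime_tournamentD tournament_finite by blast

lemma prime_homogeneous:
  assumes "prime_tournament V E" "homogeneous V E X"
  shows "X = V \<or> card X \<le> 1"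
proof -
  have "X \<subseteq> V" "finite V"
    using assms prime_finite by (auto simp: homogeneous_def)
  then have "card X < card V \<or> X = V"
    using psubset_card_mono by blast
  then show ?thesis
    using assms unfolding prime_tournament_def nontrivial_set_def by auto
qed

lemma eq_singleton_if_card_le_1: "finite A \<Longrightarrow> card A \<le> 1 \<Longrightarrow> a \<in> A \<Longrightarrow> A = {a}"
  using card_le_Suc0_iff_eq[of A] by auto

lemma card3_ex:
  assumes "3 \<le> card X" "finite X"
  shows "\<exists>x\<in>X. x \<noteq> a \<and> x \<noteq> b"
proof (rule ccontr)
  assume "\<not> ?thesis"
  then have "X \<subseteq> {a, b}" by auto
  then have "card X \<le> card {a, b}" by (intro card_mono) auto
  also have "\<dots> \<le> 2" by (simp add: card_insert_if)
  finally show False using assms by simp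
qed

lemma homogeneous_twins:
  assumes "tournament V E" "c \<in> V" "z \<in> V" "twins E V c z"
  shows "homogeneous V E {c, z}"
  using assms tournamentD[OF assms(1)] unfolding homogeneous_def twins_def by blast

lemma prime_no_twins:
  assumes "prime_tournament V E" "c \<in> V" "z \<in> V" "c \<noteq> z" "3 \<le> card V"
  shows "\<not> twins E V c z"
proof
  assume "twins E V c z"
  then have "homogeneous V E {c, z}"
    using assms homogeneous_twins prime_tournamentD by metis
  from prime_homogeneous[OF assms(1) this] show False
    using assms by (auto simp: card_insert_if)
qed

lemma prime_no_uniform:
  assumes "prime_tournament V E" "z \<in> V" "3 \<le> card V" "V - {z} \<subseteq> X"
  shows "\<not> uniform E X z"
proof
  assume "uniform E X z"
  then have "homogeneous V E (V - {z})"
    using assms by (auto simp: homogeneous_def uniform_def)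
  from prime_homogeneous[OF assms(1) this] show False
    using assms prime_finite[OF assms(1)] by auto
qed

lemma nonprime_twins:
  assumes "c \<in> X" "z \<notin> X" "3 \<le> card X" "twins E X c z"
  shows "\<not> prime_tournament (insert z X) E"
proof
  assume p: "prime_tournament (insert z X) E"
  have "finite X" using prime_finite[OF p] by simp
  moreover have "twins E (insert z X) c z"
    using assms unfolding twins_def by blast
  ultimately show False
    using prime_no_twins[OF p, of c z] assms by (simp add: card_insert_if) blast
qed

lemma nonprime_uniform:
  assumes "z \<notin> X" "3 \<le> card X" "uniform E X z"
  shows "\<not> prime_tournament (insert z X) E"
proof
  assume p: "prime_tournament (insert z X) E"
  have "finite X" using prime_finite[OF p] by simp
  then show False
    using prime_no_uniform[OF p, of z X] assms by (simp add: card_insert_if)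
qed

text \<open>A nontrivial homogeneous set \<open>Y\<close> of the extension meets \<open>X\<close> in
  a homogeneous set of \<open>X\<close>, hence in all of \<open>X\<close> or in at most one vertex.
  So \<open>Y\<close> is \<open>X\<close> itself, or \<open>z\<close> together with one vertex
  \<open>c\<close>.\<close>

lemma nonprime_extension_cases:
  assumes X: "prime_tournament X E" and t: "tournament (insert z X) E"
    and z: "z \<notin> X" and np: "\<not> prime_tournament (insert z X) E"
  shows "uniform E X z \<or> (\<exists>c\<in>X. twins E X c z)"
proof -
  have fin: "finite X" using X prime_finite by blast
  obtain Y where Y: "homogeneous (insert z X) E Y" "1 < card Y" "card Y < card (insert z X)"
    using np t unfolding prime_tournament_def nontrivial_set_def by blast
  have sub: "Y \<subseteq> insert z X" using Y(1) by (simp add: homogeneous_def)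
  have "homogeneous X E (Y \<inter> X)"
    using Y(1) z unfolding homogeneous_def by blast
  from prime_homogeneous[OF X this] consider "X \<subseteq> Y" | "card (Y \<inter> X) \<le> 1" by blast
  then show ?thesis
  proof cases
    case 1
    have "\<not> insert z X \<subseteq> Y" using sub Y(3) by (metis less_irrefl subset_antisym)
    then have "z \<notin> Y" using 1 by blast
    then show ?thesis using Y(1) 1 unfolding homogeneous_def uniform_def by blast
  next
    case 2
    have "z \<in> Y"
      using 2 Y(2) sub by (metis Int_absorb2 not_less subset_insert)
    have "Y = insert z (Y \<inter> X)" using sub \<open>z \<in> Y\<close> by blast
    then have "Y \<inter> X \<noteq> {}" using Y(2) by (metis One_nat_def card.empty card.insert empty_iff finite.emptyI less_irrefl)
    then obtain c where c: "c \<in> Y" "c \<in> X" by blast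
    have "Y \<inter> X = {c}"
      using 2 c fin by (intro eq_singleton_if_card_le_1) auto
    have "E v c \<longleftrightarrow> E v z" if v: "v \<in> X - {c, z}" for v
    proof -
      have "v \<in> insert z X - Y" using v \<open>Y \<inter> X = {c}\<close> by blast
      then have "(E v c \<and> E v z) \<or> (E c v \<and> E z v)"
        using Y(1) c \<open>z \<in> Y\<close> unfolding homogeneous_def by blast
      then show ?thesis using tournamentD[OF t, of v c] tournamentD[OF t, of v z] v c z by blast
    qed
    then show ?thesis using c unfolding twins_def by blast
  qed
qed

text \<open>Here \<open>b\<close> is a clone of \<open>c\<close> that \<open>y\<close> tells apart
  from it. A nontrivial homogeneous \<open>Y\<close> again traces all of \<open>X\<close> or at most
  one vertex of it. Each case clashes with \<open>y\<close> separating \<open>b\<close> from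
  \<open>c\<close>, makes \<open>y\<close> a twin of \<open>c\<close>, or violates primality of
  \<open>X\<close>.\<close>

lemma prime_two_extension_aux:
  assumes X: "prime_tournament X E" "3 \<le> card X" and t: "tournament (insert b (insert y X)) E"
    and b: "b \<notin> X" and y: "y \<notin> X" "y \<noteq> b"
    and c: "c \<in> X" "twins E X c b" and yc: "\<not> twins E X c y" and d: "E y b \<noteq> E y c"
  shows "prime_tournament (insert b (insert y X)) E"
proof (rule ccontr)
  let ?Z = "insert b (insert y X)"
  assume np: "\<not> prime_tournament ?Z E"
  have fin: "finite X" using X prime_finite by blast
  have T: "E v w \<longleftrightarrow> \<not> E w v" if "v \<in> ?Z" "w \<in> ?Z" "v \<noteq> w" for v w
    using t that tournamentD by metis
  obtain Y where Y: "homogeneous ?Z E Y" "1 < card Y" "card Y < card ?Z"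
    using np t unfolding prime_tournament_def nontrivial_set_def by blast
  have sub: "Y \<subseteq> ?Z" using Y(1) by (simp add: homogeneous_def)
  have hom: "E v x \<longleftrightarrow> E v x'" if "v \<in> ?Z" "v \<notin> Y" "x \<in> Y" "x' \<in> Y" for v x x'
  proof -
    have "(E v x \<and> E v x') \<or> (E x v \<and> E x' v)"
      using Y(1) that unfolding homogeneous_def by blast
    then show ?thesis using T[of v x] T[of v x'] that sub by blast
  qed
  \<comment> \<open>If \<open>b\<close> and \<open>u\<close> lie in \<open>Y\<close> with no further
    vertex of \<open>X\<close>, then \<open>u\<close> is a twin of \<open>b\<close>, hence of
    \<open>c\<close>, inside the prime \<open>X\<close>.\<close>
  have unique: "u = c" if u: "u \<in> X" "u \<in> Y" "b \<in> Y" "Y \<inter> X \<subseteq> {u}" for u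
  proof (rule ccontr)
    assume "u \<noteq> c"
    have "E v u \<longleftrightarrow> E v c" if "v \<in> X" "v \<noteq> u" "v \<noteq> c" for v
      using that hom[of v u b] u twinsD[OF c(2), of v] b by blast
    then have "twins E X u c" unfolding twins_def by blast
    then show False using prime_no_twins[OF X(1) u(1) c(1) \<open>u \<noteq> c\<close> X(2)] by blast
  qed
  have "homogeneous X E (Y \<inter> X)"
    using Y(1) b y unfolding homogeneous_def by blast
  from prime_homogeneous[OF X(1) this] consider "X \<subseteq> Y" | "card (Y \<inter> X) \<le> 1" by blast
  then show False
  proof cases
    case 1
    show False
    proof (cases "b \<in> Y")
      case True
      have "\<not> ?Z \<subseteq> Y" using sub Y(3) by (metis less_irrefl subset_antisym)
      then have "y \<notin> Y" using 1 True by blast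
      then show False using hom[of y b c] 1 True c d by blast
    next
      case False
      \<comment> \<open>Outside \<open>Y\<close>, the vertex \<open>b\<close> is uniform over
        \<open>X\<close>, and its twin \<open>c\<close> inherits this over
        \<open>X - {c}\<close>.\<close>
      then have "(\<forall>x\<in>X. E b x) \<or> (\<forall>x\<in>X. E x b)"
        using Y(1) 1 unfolding homogeneous_def by blast
      then have "(\<forall>x\<in>X - {c}. E c x) \<or> (\<forall>x\<in>X - {c}. E x c)"
        using twinsD[OF c(2)] T[of b] T[of c] b c(1) by (metis Diff_iff insertCI)
      then show False using prime_no_uniform[OF X(1) c(1) X(2), of "X - {c}"] unfolding uniform_def by blast
    qed
  next
    case 2
    show False
    proof (cases "Y \<inter> X = {}")
      case True
      then have "Y \<subseteq> {b, y}" using sub by blast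
      then have "Y = {b, y}"
        using Y(2) y by (intro card_seteq) (auto simp: card_insert_if)
      then have "E v b \<longleftrightarrow> E v y" if "v \<in> X" for v using hom[of v b y] that b y by blast
      then show False using yc c(2) b unfolding twins_def by blast
    next
      case False
      then obtain u where u: "u \<in> Y" "u \<in> X" by blast
      have Yu: "Y \<inter> X = {u}"
        using 2 u fin by (intro eq_singleton_if_card_le_1) auto
      show False
      proof (cases "b \<in> Y")
        case True
        then have "u = c" using unique u Yu by blast
        show False
        proof (cases "y \<in> Y")
          case True
          have "E v c \<longleftrightarrow> E v y" if "v \<in> X" "v \<noteq> c" for v
            using hom[of v c y] that Yu \<open>u = c\<close> True u by blast
          then show False using yc unfolding twins_def by blast
        next
          case False
          then show False using hom[of y b c] True \<open>u = c\<close> u d by blast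
        qed
      next
        case False
        have "y \<in> Y"
        proof (rule ccontr)
          assume "y \<notin> Y"
          then have "Y = {u}" using Yu False sub by blast
          then show False using Y(2) by simp
        qed
        have tu: "E v u \<longleftrightarrow> E v y" if "v \<in> X" "v \<noteq> u" for v
          using hom[of v u y] that Yu u \<open>y \<in> Y\<close> by blast
        then have "twins E X u y" unfolding twins_def by blast
        then have "u \<noteq> c" using yc by blast
        \<comment> \<open>\<open>b\<close> treats \<open>y\<close> like \<open>u\<close>,
          \<open>c\<close> treats \<open>u\<close> as \<open>b\<close> does, and \<open>c\<close>
          treats \<open>y\<close> like \<open>u\<close>; so \<open>y\<close> would not separate
          \<open>b\<close> from \<open>c\<close>.\<close>
        have "E b u \<longleftrightarrow> E b y" using hom[of b u y] False u \<open>y \<in> Y\<close> by blast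
        moreover have "E u b \<longleftrightarrow> E u c" using twinsD[OF c(2) u(2)] \<open>u \<noteq> c\<close> b u by blast
        moreover have "E c u \<longleftrightarrow> E c y" using tu c \<open>u \<noteq> c\<close> by blast
        ultimately show False
          using T[of b u] T[of c u] T[of b y] T[of c y] c u b y d \<open>u \<noteq> c\<close> by blast
      qed
    qed
  qed
qed

text \<open>Some outside vertex is a twin of a vertex \<open>c\<close> of \<open>X\<close>, since
  otherwise \<open>X\<close> would be homogeneous in \<open>V\<close>. The class of twins of
  \<open>c\<close> is split by some vertex \<open>y\<close>, which supplies the pair to add.\<close>

lemma prime_two_extension:
  assumes V: "prime_tournament V E" and X: "prime_tournament X E" "3 \<le> card X" "X \<subset> V"
    and next': "\<And>z. z \<in> V - X \<Longrightarrow> \<not> prime_tournament (insert z X) E"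
  shows "\<exists>x\<in>V - X. \<exists>y\<in>V - X. x \<noteq> y \<and> prime_tournament (insert x (insert y X)) E"
proof -
  have tV: "tournament V E" using V prime_tournamentD by blast
  have fV: "finite V" using V prime_finite by blast
  have cl: "uniform E X z \<or> (\<exists>c\<in>X. twins E X c z)" if "z \<in> V - X" for z
    using nonprime_extension_cases[OF X(1), of z] next'[OF that] that X(3)
      tournament_subset[OF tV, of "insert z X"] by blast
  have "\<not> (\<forall>z\<in>V - X. uniform E X z)"
  proof
    assume "\<forall>z\<in>V - X. uniform E X z"
    then have "homogeneous V E X" using X(3) unfolding homogeneous_def uniform_def by blast
    from prime_homogeneous[OF V this] show False using X by auto
  qed
  then obtain x c where x: "x \<in> V - X" "c \<in> X" "twins E X c x" using cl by blast
  \<comment> \<open>\<open>B\<close> has more than one vertex and misses part of \<open>X\<close>,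
    so it is not homogeneous in the prime \<open>V\<close>.\<close>
  define B where "B = insert c {b \<in> V - X. twins E X c b}"
  have "B \<subseteq> V" using x X by (auto simp: B_def)
  have "card {c, x} \<le> card B"
    using x finite_subset[OF \<open>B \<subseteq> V\<close> fV] by (intro card_mono) (auto simp: B_def)
  moreover have "card {c, x} = 2" using x by (auto simp: card_insert_if)
  ultimately have "1 < card B" by simp
  moreover have "B \<noteq> V"
    using card3_ex[OF X(2) prime_finite[OF X(1)], of c c] X(3) by (auto simp: B_def)
  ultimately have "\<not> homogeneous V E B" using prime_homogeneous[OF V, of B] by auto
  then obtain y b0 b1 where y: "y \<in> V - B" "b0 \<in> B" "b1 \<in> B" "\<not> E y b0" "\<not> E b1 y"
    using \<open>B \<subseteq> V\<close> unfolding homogeneous_def by blast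
  have "E y b1" using y \<open>B \<subseteq> V\<close> tournamentD[OF tV, of y b1] by blast
  \<comment> \<open>\<open>y\<close> treats \<open>b0\<close> and \<open>b1\<close> differently, so
    at least one of them is treated unlike \<open>c\<close>.\<close>
  then obtain b where b: "b \<in> B" "E y b \<noteq> E y c" using y by metis
  then have b': "b \<in> V - X" "twins E X c b" by (auto simp: B_def)
  have "y \<notin> X"
  proof
    assume "y \<in> X"
    then show False using twinsD[OF b'(2), of y] b y b' by (auto simp: B_def)
  qed
  have nt: "\<not> twins E X c y" using y \<open>y \<notin> X\<close> by (auto simp: B_def)
  have t: "tournament (insert b (insert y X)) E"
    using tournament_subset[OF tV, of "insert b (insert y X)"] b' y X by blast
  have "y \<noteq> b" using b y by blast
  have "b \<notin> X" using b' by blast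
  have "prime_tournament (insert b (insert y X)) E"
    by (rule prime_two_extension_aux[OF X(1,2) t \<open>b \<notin> X\<close> \<open>y \<notin> X\<close> \<open>y \<noteq> b\<close> x(2) b'(2) nt b(2)])
  then show ?thesis using b' y \<open>y \<notin> X\<close> \<open>y \<noteq> b\<close> by (metis DiffD1 DiffI)
qed

section \<open>Zigzag tournaments\<close>

text \<open>For \<^term>\<open>a < b\<close> the arc between \<^term>\<open>p a\<close> and \<^term>\<open>p b\<close> goes forward if the parities
  of the indices differ, and otherwise according to one bit per parity class. In this indexing,
  T has both bits false, U has \<^term>\<open>ee\<close> only, and W minus its last vertex has both.\<close>
definition zigzag :: "('a \<Rightarrow> 'a \<Rightarrow> bool) \<Rightarrow> (nat \<Rightarrow> 'a) \<Rightarrow> nat \<Rightarrow> bool \<Rightarrow> bool \<Rightarrow> bool" where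
  "zigzag E p m ee oo \<longleftrightarrow> (\<forall>a b. 1 \<le> a \<and> a < b \<and> b \<le> m \<longrightarrow>
     (E (p a) (p b) \<longleftrightarrow> odd a \<noteq> odd b \<or> (if odd a then oo else ee)))"

lemma zigzagD: "zigzag E p m ee oo \<Longrightarrow> 1 \<le> a \<Longrightarrow> a < b \<Longrightarrow> b \<le> m \<Longrightarrow>
    E (p a) (p b) \<longleftrightarrow> odd a \<noteq> odd b \<or> (if odd a then oo else ee)"
  unfolding zigzag_def by blast

lemma zigzag_edge:
  assumes z: "zigzag E p m ee oo" and t: "tournament K E" and p: "inj_on p {1..m}" "p ` {1..m} \<subseteq> K"
    and a: "a \<in> {1..m}" and b: "b \<in> {1..m}"
  shows "E (p a) (p b) \<longleftrightarrow>
    (if a < b then odd a \<noteq> odd b \<or> (if odd a then oo else ee)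
     else a \<noteq> b \<and> \<not> (odd a \<noteq> odd b \<or> (if odd a then oo else ee)))"
proof -
  have K: "p a \<in> K" "p b \<in> K" using p a b by auto
  consider "a < b" | "a = b" | "b < a" by linarith
  then show ?thesis
  proof cases
    case 1
    then show ?thesis using zigzagD[OF z, of a b] a b by auto
  next
    case 2
    then show ?thesis using tournament_irrefl[OF t K(1)] by simp
  next
    case 3
    then have "p a \<noteq> p b" using p(1) a b by (auto dest: inj_onD)
    then show ?thesis using 3 zigzagD[OF z, of b a] tournamentD[OF t K] a b by auto
  qed
qed

section \<open>Identification of zigzags with T, U and W\<close>

lemma tourn_iso_via:
  assumes p: "bij_betw p I V" and g: "bij_betw g I W"
    and e: "\<And>a b. a \<in> I \<Longrightarrow> b \<in> I \<Longrightarrow> E (p a) (p b) \<longleftrightarrow> E' (g a) (g b)"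
  shows "tourn_iso V E W E'"
proof -
  have "bij_betw (g \<circ> inv_into I p) V W"
    using bij_betw_trans[OF bij_betw_inv_into[OF p] g] .
  moreover have "E u v \<longleftrightarrow> E' ((g \<circ> inv_into I p) u) ((g \<circ> inv_into I p) v)" if "u \<in> V" "v \<in> V" for u v
  proof -
    have "inv_into I p x \<in> I \<and> p (inv_into I p x) = x" if "x \<in> V" for x
      using that p by (metis bij_betw_def f_inv_into_f inv_into_into)
    then show ?thesis using e[of "inv_into I p u" "inv_into I p v"] that by simp
  qed
  ultimately show ?thesis unfolding tourn_iso_def by blast
qed

lemma bij_betw_selfI: "inj_on g {1..m::nat} \<Longrightarrow> g ` {1..m} \<subseteq> {1..m} \<Longrightarrow> bij_betw g {1..m} {1..m}"
  unfolding bij_betw_def by (simp add: card_image card_subset_eq)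

lemma T_edge_iff:
  assumes "i \<in> {1..n}" "j \<in> {1..n}" "odd n"
  shows "T_edge n i j \<longleftrightarrow> (if i \<le> j then 1 \<le> j - i \<and> j - i \<le> n div 2 else j + n - i \<le> n div 2)"
proof -
  have "(j + n - i) mod n = (if i \<le> j then j - i else j + n - i)"
  proof (cases "i \<le> j")
    case True
    then have "(j + n - i) mod n = (j - i + n) mod n" by simp
    also have "\<dots> = (j - i) mod n" by simp
    also have "j - i < n" using assms by auto
    then have "(j - i) mod n = j - i" by simp
    finally show ?thesis using True by simp
  next
    case False
    then show ?thesis using assms by simp
  qed
  moreover have "1 \<le> j + n - i" using assms by auto
  ultimately show ?thesis unfolding T_edge_def Let_def by simp
qed

lemma zigzag_T:
  assumes t: "tournament V E" and p: "bij_betw p {1..m} V" and m: "odd m" and z: "zigzag E p m False False"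
  shows "tourn_iso V E {1..m} (T_edge m)"
proof -
  \<comment> \<open>With \<open>m = 2k + 1\<close>, \<open>g\<close> starts at \<open>k + 1\<close>
    and advances by \<open>k\<close> around the circle at each step of the path: odd indices descend
    from \<open>k + 1\<close> to 1, even ones from \<open>m\<close> to \<open>k + 2\<close>.\<close>
  define g where "g a = (if odd a then (m - a) div 2 + 1 else m - a div 2 + 1)" for a
  obtain k where k: "m = 2 * k + 1" using m oddE by blast
  have half [simp]: "(2 * k - 2 * x) div 2 = k - x" for x
    by (simp add: diff_mult_distrib2[symmetric])
  have g0: "g (2 * x) = 2 * k + 1 - x + 1" and g1: "g (2 * x + 1) = k - x + 1" for x
    by (simp_all add: g_def k)
  have rng: "g a \<in> {1..m}" if "a \<in> {1..m}" for a
  proof -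
    obtain x where x: "a = 2 * x \<or> a = 2 * x + 1" by (metis evenE oddE)
    then show ?thesis using that unfolding k by (elim disjE) (simp_all only: g0 g1, auto)
  qed
  have inj: "inj_on g {1..m}"
  proof (rule inj_onI)
    fix a b assume ab: "a \<in> {1..m}" "b \<in> {1..m}" "g a = g b"
    obtain x where x: "a = 2 * x \<or> a = 2 * x + 1" by (metis evenE oddE)
    obtain y where y: "b = 2 * y \<or> b = 2 * y + 1" by (metis evenE oddE)
    show "a = b" using x y ab unfolding k by (elim disjE) (simp_all only: g0 g1, auto)
  qed
  have e: "E (p a) (p b) \<longleftrightarrow> T_edge m (g a) (g b)" if "a \<in> {1..m}" "b \<in> {1..m}" for a b
  proof -
    have "E (p a) (p b) \<longleftrightarrow> (if a < b then odd a \<noteq> odd b else a \<noteq> b \<and> odd a = odd b)"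
      using zigzag_edge[OF z t, of a b] p that by (auto simp: bij_betw_def)
    also have "\<dots> \<longleftrightarrow> T_edge m (g a) (g b)"
    proof -
      obtain x where x: "a = 2 * x \<or> a = 2 * x + 1" by (metis evenE oddE)
      obtain y where y: "b = 2 * y \<or> b = 2 * y + 1" by (metis evenE oddE)
      have n: "m div 2 = k" by (simp add: k)
      have E: "T_edge m (g a) (g b) \<longleftrightarrow> (if g a \<le> g b then 1 \<le> g b - g a \<and> g b - g a \<le> k else g b + m - g a \<le> k)"
        unfolding T_edge_iff[OF rng[OF that(1)] rng[OF that(2)] m] n by (auto simp: Let_def)
      show ?thesis
        using x y that unfolding E unfolding k by (elim disjE) (simp_all only: g0 g1, auto)
    qed
    finally show ?thesis .
  qed
  have "bij_betw g {1..m} {1..m}" using bij_betw_selfI[OF inj] rng by blast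
  then show ?thesis by (rule tourn_iso_via[OF p]) (rule e)
qed

lemma zigzag_U:
  assumes t: "tournament V E" and p: "bij_betw p {1..m} V" and m: "odd m" and z: "zigzag E p m True False"
  shows "tourn_iso V E {1..m} (U_edge m)"
proof -
  \<comment> \<open>The numbering used for T, rotated by \<open>k\<close>: the even indices now fill
    \<open>{1..k}\<close>, the block whose arcs U reverses, which accounts for the bit
    \<open>True\<close>.\<close>
  define g where "g a = (if odd a then m div 2 + 1 + (m - a) div 2 else m div 2 + 1 - a div 2)" for a
  obtain k where k: "m = 2 * k + 1" using m oddE by blast
  have half [simp]: "(2 * k - 2 * x) div 2 = k - x" for x
    by (simp add: diff_mult_distrib2[symmetric])
  have g0: "g (2 * x) = k + 1 - x" and g1: "g (2 * x + 1) = k + 1 + (k - x)" for x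
    by (simp_all add: g_def k)
  have rng: "g a \<in> {1..m}" if "a \<in> {1..m}" for a
  proof -
    obtain x where x: "a = 2 * x \<or> a = 2 * x + 1" by (metis evenE oddE)
    then show ?thesis using that unfolding k by (elim disjE) (simp_all only: g0 g1, auto)
  qed
  have inj: "inj_on g {1..m}"
  proof (rule inj_onI)
    fix a b assume ab: "a \<in> {1..m}" "b \<in> {1..m}" "g a = g b"
    obtain x where x: "a = 2 * x \<or> a = 2 * x + 1" by (metis evenE oddE)
    obtain y where y: "b = 2 * y \<or> b = 2 * y + 1" by (metis evenE oddE)
    show "a = b" using x y ab unfolding k by (elim disjE) (simp_all only: g0 g1, auto)
  qed
  have e: "E (p a) (p b) \<longleftrightarrow> U_edge m (g a) (g b)" if "a \<in> {1..m}" "b \<in> {1..m}" for a b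
  proof -
    have "E (p a) (p b) \<longleftrightarrow> (if a < b then even a \<or> even b else a \<noteq> b \<and> odd a \<and> odd b)"
      using zigzag_edge[OF z t, of a b] p that by (auto simp: bij_betw_def)
    also have "\<dots> \<longleftrightarrow> U_edge m (g a) (g b)"
    proof -
      obtain x where x: "a = 2 * x \<or> a = 2 * x + 1" by (metis evenE oddE)
      obtain y where y: "b = 2 * y \<or> b = 2 * y + 1" by (metis evenE oddE)
      have n: "m div 2 = k" by (simp add: k)
      have E: "U_edge m (g a) (g b) \<longleftrightarrow> (if g a \<le> k \<and> g b \<le> k
          then (if g b \<le> g a then 1 \<le> g a - g b \<and> g a - g b \<le> k else g a + m - g b \<le> k)
          else (if g a \<le> g b then 1 \<le> g b - g a \<and> g b - g a \<le> k else g b + m - g a \<le> k))"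
        unfolding U_edge_def T_edge_iff[OF rng[OF that(1)] rng[OF that(2)] m]
        T_edge_iff[OF rng[OF that(2)] rng[OF that(1)] m] n by (auto simp: Let_def)
      show ?thesis
        using x y that unfolding E unfolding k by (elim disjE) (simp_all only: g0 g1, auto)
    qed
    finally show ?thesis .
  qed
  have "bij_betw g {1..m} {1..m}" using bij_betw_selfI[OF inj] rng by blast
  then show ?thesis by (rule tourn_iso_via[OF p]) (rule e)
qed

text \<open>With both bits \<open>True\<close> the path is a transitive order, so the indexing
  itself is the isomorphism, with \<open>r\<close> appended as the last vertex.\<close>

lemma zigzag_W:
  assumes t: "tournament V E" and p: "bij_betw p {1..m} (V - {r})" and r: "r \<in> V" and m: "even m"
    and z: "zigzag E p m True True" and er: "\<And>a. a \<in> {1..m} \<Longrightarrow> E (p a) r \<longleftrightarrow> even a"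
  shows "tourn_iso V E {1..m + 1} (W_edge (m + 1))"
proof -
  define q where "q = p(m + 1 := r)"
  have pV: "p a \<in> V" "p a \<noteq> r" if "a \<in> {1..m}" for a
    using p that by (auto simp: bij_betw_def)
  have "bij_betw q {1..m} (V - {r})"
    using p bij_betw_cong[of "{1..m}" p q] by (simp add: q_def)
  then have "bij_betw q ({1..m} \<union> {m + 1}) ((V - {r}) \<union> {r})"
    by (rule bij_betw_combine) (auto simp: q_def bij_betw_def)
  moreover have "{1..m} \<union> {m + 1} = {1..m + 1}" "(V - {r}) \<union> {r} = V" using r by auto
  ultimately have q: "bij_betw q {1..m + 1} V" by simp
  have e: "E (q a) (q b) \<longleftrightarrow> W_edge (m + 1) (id a) (id b)" if "a \<in> {1..m + 1}" "b \<in> {1..m + 1}" for a b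
  proof -
    have "a \<le> m \<or> a = m + 1" "b \<le> m \<or> b = m + 1" using that by auto
    then consider "a \<le> m" "b \<le> m" | "a \<le> m" "b = m + 1" | "a = m + 1" "b \<le> m" | "a = m + 1" "b = m + 1"
      by blast
    then show ?thesis
    proof cases
      case 1
      then show ?thesis
        using zigzag_edge[OF z t, of a b] p that by (auto simp: bij_betw_def q_def W_edge_def)
    next
      case 2
      then show ?thesis using er[of a] that by (auto simp: q_def W_edge_def)
    next
      case 3
      then show ?thesis using er[of b] that pV[of b] tournamentD[OF t, of r "p b"] r
        by (auto simp: q_def W_edge_def)
    next
      case 4
      then show ?thesis using tournament_irrefl[OF t r] by (simp add: q_def W_edge_def)
    qed
  qed
  show ?thesis by (rule tourn_iso_via[OF q bij_betw_id]) (rule e)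
qed

section \<open>Final segments up to the deletion of adjacent pairs\<close>

text \<open>The indices satisfying \<open>h\<close> form a final segment of \<open>S\<close>. The
  form relative to \<open>S\<close> allows for deleted pairs of indices.\<close>

definition ascending :: "(nat \<Rightarrow> bool) \<Rightarrow> nat set \<Rightarrow> bool" where
  "ascending h S \<longleftrightarrow> (\<forall>i\<in>S. \<forall>j\<in>S. i < j \<and> h i \<longrightarrow> h j)"

lemma ascendingD: "ascending h S \<Longrightarrow> i \<in> S \<Longrightarrow> j \<in> S \<Longrightarrow> i < j \<Longrightarrow> h i \<Longrightarrow> h j"
  unfolding ascending_def by blast

lemma not_ascending_descent:
  assumes "\<not> ascending h {1..m}"
  obtains a where "1 \<le> a" "a < m" "h a" "\<not> h (a + 1)"
proof -
  have "\<exists>a. 1 \<le> a \<and> a < m \<and> h a \<and> \<not> h (a + 1)"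
  proof (rule ccontr)
    assume n: "\<not> ?thesis"
    have step: "h (i + d)" if "1 \<le> i" "i + d \<le> m" "h i" for i d
      using that n by (induction d) auto
    have "ascending h {1..m}" unfolding ascending_def
    proof (intro ballI impI)
      fix i j assume "i \<in> {1..m}" "j \<in> {1..m}" "i < j \<and> h i"
      then show "h j" using step[of i "j - i"] by auto
    qed
    then show False using assms by blast
  qed
  then show ?thesis using that by blast
qed

lemma ascending_threshold:
  assumes "ascending h {1..m}"
  obtains a where "a \<le> m" "\<And>i. i \<in> {1..m} \<Longrightarrow> h i \<longleftrightarrow> a < i"
proof -
  \<comment> \<open>The last index where \<open>h\<close> fails; the default 0 means that it holds
    throughout.\<close>
  define a where "a = Max (insert 0 {i \<in> {1..m}. \<not> h i})"
  have ai: "a \<in> insert 0 {i \<in> {1..m}. \<not> h i}" unfolding a_def by (intro Max_in) auto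
  have ge: "i \<le> a" if "i \<in> {1..m}" "\<not> h i" for i
    unfolding a_def using that by (intro Max_ge) auto
  have "h i \<longleftrightarrow> a < i" if i: "i \<in> {1..m}" for i
  proof
    assume hi: "h i"
    show "a < i"
    proof (rule ccontr)
      assume "\<not> a < i"
      then have "a \<in> {1..m}" "\<not> h a" using ai i by auto
      then have "i < a" using hi \<open>\<not> a < i\<close> by (metis linorder_neqE_nat)
      then show False using ascendingD[OF assms i \<open>a \<in> {1..m}\<close> _ hi] \<open>\<not> h a\<close> by blast
    qed
  next
    assume "a < i"
    then show "h i" using ge[OF i] by (meson not_le)
  qed
  moreover have "a \<le> m" using ai by auto
  ultimately show ?thesis using that by blast
qed

text \<open>A failure of \<^const>\<open>ascending\<close> is witnessed by an adjacent descent, so a deleted pair disjoint from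
  a descent of \<^term>\<open>h1\<close> and one of \<^term>\<open>h2\<close> gives a contradiction. Such a pair exists except for
  \<^term>\<open>m = (7::nat)\<close> with descents at 2 and 5, where the condition at index 3 is needed.\<close>
lemma ascending_local2:
  assumes m: "7 \<le> m" and h: "h1 3 \<noteq> h2 3"
    and del: "\<And>i. 1 \<le> i \<Longrightarrow> i < m \<Longrightarrow>
      ascending h1 ({1..m} - {i, i + 1}) \<or> ascending h2 ({1..m} - {i, i + 1})"
  shows "ascending h1 {1..m} \<or> ascending h2 {1..m}"
proof (rule ccontr)
  assume "\<not> ?thesis"
  then have n: "\<not> ascending h1 {1..m}" "\<not> ascending h2 {1..m}" by blast+
  obtain a where a: "1 \<le> a" "a < m" "h1 a" "\<not> h1 (a + 1)"
    by (rule not_ascending_descent[OF n(1)])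
  obtain b where b: "1 \<le> b" "b < m" "h2 b" "\<not> h2 (b + 1)"
    by (rule not_ascending_descent[OF n(2)])
  have clash: "\<not> (1 \<le> i \<and> i < m \<and> {i, i + 1} \<inter> {a, a + 1, b, b + 1} = {})" for i
  proof
    assume i: "1 \<le> i \<and> i < m \<and> {i, i + 1} \<inter> {a, a + 1, b, b + 1} = {}"
    define S where "S = {1..m} - {i, i + 1}"
    have "a \<in> S" "a + 1 \<in> S" "b \<in> S" "b + 1 \<in> S" using i a b by (auto simp: S_def)
    then show False
      using del[of i, folded S_def] i ascendingD[of h1 S a "a + 1"] ascendingD[of h2 S b "b + 1"] a b
      by auto
  qed
  \<comment> \<open>So the two descents together meet every pair of consecutive indices.\<close>
  have hit: "a = i \<or> a + 1 = i \<or> a = i + 1 \<or> b = i \<or> b + 1 = i \<or> b = i + 1" if "1 \<le> i" "i < m" for i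
    using clash[of i] that by auto
  have "a = 1 \<or> a = 2 \<or> b = 1 \<or> b = 2" using hit[of 1] a b m by auto
  then have c: "m = 7 \<and> (a = 2 \<and> b = 5 \<or> a = 5 \<and> b = 2)"
    using hit[of 3] hit[of 4] hit[of 5] hit[of 6] hit[of 7] m by (elim disjE[of "_ = _"]; cases "m = 7"; auto)
  have m7: "m = 7" using c by blast
  show False
  proof (cases "a = 2")
    case True
    then have ab: "a = 2" "b = 5" using c by auto
    \<comment> \<open>Deleting 4 and 5 keeps the descent of \<open>h1\<close> at 2, so
      \<open>h2\<close> is ascending there. Its failure at 6 forces failure at 3, where
      \<open>h1\<close> fails as well.\<close>
    have "ascending h2 ({1..m} - {4, 5})"
      using del[of 4] ascendingD[of h1 "{1..m} - {4, 5}" 2 3] a ab m7 by auto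
    then have "\<not> h2 3" using ascendingD[of h2 "{1..m} - {4, 5}" 3 6] b ab m7 by auto
    then show False using a ab h by simp
  next
    case False
    then have ab: "a = 5" "b = 2" using c by auto
    have "ascending h1 ({1..m} - {4, 5})"
      using del[of 4] ascendingD[of h2 "{1..m} - {4, 5}" 2 3] b ab m7 by auto
    then have "\<not> h1 3" using ascendingD[of h1 "{1..m} - {4, 5}" 3 6] a ab m7 by auto
    then show False using b ab h by simp
  qed
qed

text \<open>The second alternative is the pattern of arcs out of the extra vertex of W. A descent
  and a mismatch with this pattern occupy too few indices to meet three disjoint pairs.\<close>

lemma ascending_local1:
  assumes m: "6 \<le> m"
    and del: "\<And>i. 1 \<le> i \<Longrightarrow> i < m \<Longrightarrow>
      ascending f ({1..m} - {i, i + 1}) \<or> (\<forall>j\<in>{1..m} - {i, i + 1}. f j \<longleftrightarrow> odd j)"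
  shows "ascending f {1..m} \<or> (\<forall>j\<in>{1..m}. f j \<longleftrightarrow> odd j)"
proof (rule ccontr)
  assume "\<not> ?thesis"
  then have n: "\<not> ascending f {1..m}" and "\<exists>b. 1 \<le> b \<and> b \<le> m \<and> f b \<noteq> odd b" by auto
  then obtain b where b: "1 \<le> b" "b \<le> m" "f b \<noteq> odd b" by blast
  obtain a where a: "1 \<le> a" "a < m" "f a" "\<not> f (a + 1)"
    by (rule not_ascending_descent[OF n])
  \<comment> \<open>An even descent \<open>a\<close> is itself a mismatch and needs no further
    index, while for odd \<open>a\<close> the indices \<open>a\<close> and \<open>a + 1\<close> meet
    at most one of the pairs \<open>{1, 2}\<close>, \<open>{3, 4}\<close>, \<open>{5, 6}\<close>.
    Either way \<open>{a, a + 1, c}\<close> misses one of these pairs.\<close>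
  define c where "c = (if even a then a else b)"
  have c: "1 \<le> c" "c \<le> m" "f c \<noteq> odd c" "even a \<longrightarrow> c = a" using a b by (auto simp: c_def)
  have clash: "\<not> (1 \<le> i \<and> i < m \<and> {i, i + 1} \<inter> {a, a + 1, c} = {})" for i
  proof
    assume i: "1 \<le> i \<and> i < m \<and> {i, i + 1} \<inter> {a, a + 1, c} = {}"
    define S where "S = {1..m} - {i, i + 1}"
    have "a \<in> S" "a + 1 \<in> S" "c \<in> S" using i a c by (auto simp: S_def)
    then show False
      using del[of i, folded S_def] i ascendingD[of f S a "a + 1"] a c by auto
  qed
  have hit: "a = i \<or> a + 1 = i \<or> a = i + 1 \<or> c = i \<or> c = i + 1" if "1 \<le> i" "i < m" for i
    using clash[of i] that by auto
  have "a = 1 \<or> a = 2 \<or> c = 1 \<or> c = 2" using hit[of 1] a c m by auto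
  then show False
    using hit[of 3] hit[of 4] hit[of 5] m c(4) by (elim disjE[of "_ = _"]) auto
qed

section \<open>Paths of good pairs\<close>

text \<open>The set \<^term>\<open>Q\<close> stands for the copies of H; the argument uses only these closure properties, which
  pass from n to n + 2.\<close>
locale stuck =
  fixes V :: "'a set" and E :: "'a \<Rightarrow> 'a \<Rightarrow> bool" and n :: nat and Q :: "'a set set"
  assumes prime_V: "prime_tournament V E" and n5: "5 \<le> n"
    and Q_sub: "X \<in> Q \<Longrightarrow> X \<subseteq> V" and Q_card: "X \<in> Q \<Longrightarrow> card X = n"
    and Q_prime: "X \<in> Q \<Longrightarrow> prime_tournament X E"
    and Q_ext: "X \<in> Q \<Longrightarrow> z \<in> V - X \<Longrightarrow> \<not> prime_tournament (insert z X) E"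
    and Q_swap: "X \<in> Q \<Longrightarrow> c \<in> X \<Longrightarrow> z \<in> V - X \<Longrightarrow> twins E X c z \<Longrightarrow> insert z (X - {c}) \<in> Q"
begin

lemma V_tournament: "tournament V E" using prime_V prime_tournamentD by blast

lemma Q_cases:
  assumes "X \<in> Q" "z \<in> V - X"
  shows "uniform E X z \<or> (\<exists>c\<in>X. twins E X c z)"
  using nonprime_extension_cases[OF Q_prime[OF assms(1)], of z] Q_ext[OF assms] Q_sub[OF assms(1)]
    tournament_subset[OF V_tournament, of "insert z X"] assms(2) by blast

end

locale stuck_pair = stuck +
  fixes K :: "'a set"
  assumes K_sub: "K \<subseteq> V" and K_prime: "prime_tournament K E" and K_card: "card K = n + 2"
    and K_Q: "\<exists>X\<in>Q. X \<subseteq> K"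
begin

definition good :: "'a \<Rightarrow> 'a \<Rightarrow> bool" where
  "good p q \<longleftrightarrow> p \<in> K \<and> q \<in> K \<and> p \<noteq> q \<and> K - {p, q} \<in> Q"

section \<open>The graph of good pairs and its degrees\<close>

lemma good_sym: "good p q \<longleftrightarrow> good q p"
  unfolding good_def by (auto simp: insert_commute)

lemma K_finite: "finite K" using K_prime prime_finite by blast

lemma K_tournament: "tournament K E" using K_prime prime_tournamentD by blast

lemma K_card3: "3 \<le> card K" using K_card n5 by simp

lemma no_twins: "c \<in> K \<Longrightarrow> z \<in> K \<Longrightarrow> c \<noteq> z \<Longrightarrow> \<not> twins E K c z"
  using prime_no_twins[OF K_prime _ _ _ K_card3] .

lemma good_no_twins:
  assumes "good p q" "c \<in> K - {p, q}" "z \<in> K - {p, q}" "c \<noteq> z"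
  shows "\<not> twins E (K - {p, q}) c z"
proof -
  have "K - {p, q} \<in> Q" using assms(1) good_def by blast
  then show ?thesis using prime_no_twins[OF Q_prime, of "K - {p, q}" c z] assms Q_card[of "K - {p, q}"] n5 by simp
qed

lemma good_no_uniform:
  assumes "good p q" "z \<in> K - {p, q}"
  shows "\<not> uniform E (K - {p, q, z}) z"
proof -
  have "K - {p, q} \<in> Q" using assms(1) good_def by blast
  then show ?thesis
    using prime_no_uniform[OF Q_prime, of "K - {p, q}" z "K - {p, q, z}"] assms Q_card[of "K - {p, q}"] n5 by auto
qed

lemma good_exists: "\<exists>p q. good p q"
proof -
  obtain X where X: "X \<in> Q" "X \<subseteq> K" using K_Q by blast
  have "card (K - X) = 2"
    using X K_finite K_card Q_card[OF X(1)] by (simp add: card_Diff_subset finite_subset)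
  then obtain p q where "K - X = {p, q}" "p \<noteq> q" by (meson card_2_iff)
  then have "K - {p, q} = X" "p \<in> K" "q \<in> K" using X by blast+
  then show ?thesis using X \<open>p \<noteq> q\<close> unfolding good_def by blast
qed

text \<open>\<open>K - {p, q}\<close> has no prime extension by \<open>q\<close>, so
  \<open>q\<close> is uniform over it or a twin of some \<open>w\<close> in it. In the latter case
  exchanging \<open>w\<close> for \<open>q\<close> yields \<open>K - {p, w}\<close>.\<close>

lemma good_step:
  assumes g: "good p q"
  shows "uniform E (K - {p, q}) q \<or> (\<exists>w. good p w \<and> w \<noteq> q \<and> twins E (K - {p}) q w)"
proof -
  have X: "K - {p, q} \<in> Q" and pq: "p \<in> K" "q \<in> K" "p \<noteq> q" using g good_def by blast+
  have q: "q \<in> V - (K - {p, q})" using pq K_sub by blast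
  from Q_cases[OF X q] show ?thesis
  proof
    assume "\<exists>c\<in>K - {p, q}. twins E (K - {p, q}) c q"
    then obtain c where c: "c \<in> K - {p, q}" "twins E (K - {p, q}) c q" by blast
    have "insert q ((K - {p, q}) - {c}) \<in> Q" by (rule Q_swap[OF X c(1) q c(2)])
    moreover have "insert q ((K - {p, q}) - {c}) = K - {p, c}" using pq c by blast
    ultimately have "good p c" unfolding good_def using pq c by auto
    moreover have "twins E (K - {p}) q c" using c unfolding twins_def by blast
    ultimately show ?thesis using c by blast
  qed blast
qed

text \<open>With another neighbour \<open>r\<close> of \<open>p\<close>, the vertex \<open>q\<close>
  would lie in the prime \<open>K - {p, r}\<close> and be uniform over the rest of it.\<close>

lemma good_degree_uniform:
  assumes "good p q" "uniform E (K - {p, q}) q" "good p r"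
  shows "r = q"
proof (rule ccontr)
  assume "r \<noteq> q"
  moreover have "uniform E (K - {p, r, q}) q" using assms(2) by (rule uniform_subset) blast
  moreover have "q \<in> K - {p, r}" using assms(1) \<open>r \<noteq> q\<close> unfolding good_def by blast
  ultimately show False using good_no_uniform[OF assms(3)] by blast
qed

text \<open>A third neighbour \<open>r\<close> of \<open>p\<close> would leave \<open>q\<close> and
  \<open>w\<close> as twins inside the prime \<open>K - {p, r}\<close>.\<close>

lemma good_degree_twins:
  assumes "twins E (K - {p}) q w" "good p q" "good p w" "q \<noteq> w" "good p r"
  shows "r = q \<or> r = w"
proof (rule ccontr)
  assume n: "\<not> ?thesis"
  have "twins E (K - {p, r}) q w" using assms(1) by (rule twins_subset) blast
  moreover have "q \<in> K - {p, r}" "w \<in> K - {p, r}" using assms n unfolding good_def by blast+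
  ultimately show False using good_no_twins[OF assms(5)] assms(4) by blast
qed

text \<open>Two neighbours rule out the uniform case of \<open>good_step\<close>, so the twin it
  supplies must be the second neighbour.\<close>

lemma good_degree:
  assumes "good p q" "good p r" "good p s" "q \<noteq> r"
  shows "s = q \<or> s = r" "twins E (K - {p}) q r"
proof -
  from good_step[OF assms(1)] obtain w where w: "good p w" "w \<noteq> q" "twins E (K - {p}) q w"
    using good_degree_uniform[OF assms(1)] assms by metis
  have "r = w" using good_degree_twins[OF w(3) assms(1) w(1) w(2)[symmetric] assms(2)] assms(4) by blast
  then show "s = q \<or> s = r" "twins E (K - {p}) q r"
    using good_degree_twins[OF w(3) assms(1) w(1) w(2)[symmetric] assms(3)] w by blast+
qed

definition good_path :: "(nat \<Rightarrow> 'a) \<Rightarrow> nat \<Rightarrow> bool" where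
  "good_path p m \<longleftrightarrow> 2 \<le> m \<and> inj_on p {1..m} \<and> p ` {1..m} \<subseteq> K \<and>
     (\<forall>i. 1 \<le> i \<and> i < m \<longrightarrow> good (p i) (p (i + 1)))"

lemma good_path_mem: "good_path p m \<Longrightarrow> 1 \<le> i \<Longrightarrow> i \<le> m \<Longrightarrow> p i \<in> K"
  unfolding good_path_def image_subset_iff by simp

lemma good_path_inj: "good_path p m \<Longrightarrow> 1 \<le> i \<Longrightarrow> i \<le> m \<Longrightarrow> 1 \<le> j \<Longrightarrow> j \<le> m \<Longrightarrow> p i = p j \<longleftrightarrow> i = j"
  using inj_on_eq_iff[of p "{1..m}" i j] unfolding good_path_def by simp

lemma good_path_edge: "good_path p m \<Longrightarrow> 1 \<le> i \<Longrightarrow> i < m \<Longrightarrow> good (p i) (p (i + 1))"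
  unfolding good_path_def by blast

lemma good_path_rev:
  assumes "good_path p m"
  shows "good_path (\<lambda>i. p (m + 1 - i)) m"
proof -
  have "good (p (m + 1 - i)) (p (m + 1 - (i + 1)))" if "1 \<le> i" "i < m" for i
  proof -
    have "good (p (m - i)) (p (m - i + 1))" using that by (intro good_path_edge[OF assms]) auto
    moreover have "m - i + 1 = m + 1 - i" using that by simp
    ultimately show ?thesis using good_sym by simp
  qed
  moreover have "inj_on (\<lambda>i. p (m + 1 - i)) {1..m}"
    by (rule inj_onI) (use good_path_inj[OF assms] in force)
  moreover have "(\<lambda>i. p (m + 1 - i)) ` {1..m} \<subseteq> K"
    using good_path_mem[OF assms] by auto
  ultimately show ?thesis using assms unfolding good_path_def by blast
qed

lemma good_path_length: "good_path p m \<Longrightarrow> m \<le> card K"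
  using card_inj_on_le[of p "{1..m}" K] K_finite unfolding good_path_def by simp

lemma maximal_good_path: "\<exists>p m. good_path p m \<and> (\<forall>p'. \<not> good_path p' (m + 1))"
proof -
  obtain a b where ab: "good a b" using good_exists by blast
  have "good_path (\<lambda>i. if i = 1 then a else b) 2"
    using ab unfolding good_path_def inj_on_def good_def by (auto simp: le_Suc_eq numeral_2_eq_2)
  then have "\<exists>p. good_path p 2" by blast
  then obtain m where "\<exists>p. good_path p m" "\<forall>m'. (\<exists>p. good_path p m') \<longrightarrow> m' \<le> m"
    using Nat.ex_has_greatest_nat[of "\<lambda>m. \<exists>p. good_path p m" 2 "card K"] good_path_length by blast
  then show ?thesis by (metis Suc_eq_plus1 not_less_eq_eq order_refl)
qed

lemma good_path_twins:
  assumes "good_path p m" "1 < i" "i < m"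
  shows "twins E (K - {p i}) (p (i - 1)) (p (i + 1))"
proof -
  have "good (p (i - 1)) (p (i - 1 + 1))" using assms by (intro good_path_edge[OF assms(1)]) auto
  then have g: "good (p i) (p (i - 1))" using assms good_sym by simp
  moreover have "good (p i) (p (i + 1))" using assms good_path_edge by simp
  moreover have "p (i - 1) \<noteq> p (i + 1)" using good_path_inj[OF assms(1), of "i - 1" "i + 1"] assms by simp
  ultimately show ?thesis using good_degree(2)[of "p i" "p (i - 1)" "p (i + 1)" "p (i - 1)"] by blast
qed

text \<open>Uniformity concerns the last vertex but one. If it fails, the last vertex has a second
  neighbour \<open>w\<close>; maximality puts \<open>w\<close> on the path, and since inner vertices
  already have two neighbours, \<open>w\<close> is the first vertex.\<close>

lemma maximal_good_path_end:
  assumes p: "good_path p m" and max: "\<And>p'. \<not> good_path p' (m + 1)"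
  shows "uniform E (K - {p m, p (m - 1)}) (p (m - 1)) \<or> (3 \<le> m \<and> good (p m) (p 1))"
proof -
  have m2: "2 \<le> m" using p good_path_def by blast
  have "good (p (m - 1)) (p (m - 1 + 1))" using m2 by (intro good_path_edge[OF p]) auto
  then have g: "good (p m) (p (m - 1))" using m2 good_sym by simp
  from good_step[OF g] show ?thesis
  proof
    assume "\<exists>w. good (p m) w \<and> w \<noteq> p (m - 1) \<and> twins E (K - {p m}) (p (m - 1)) w"
    then obtain w where w: "good (p m) w" "w \<noteq> p (m - 1)" by blast
    have "w \<in> K" "w \<noteq> p m" using w(1) unfolding good_def by auto
    have "w \<in> p ` {1..m}"
    proof (rule ccontr)
      assume nw: "w \<notin> p ` {1..m}"
      let ?p = "p(m + 1 := w)"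
      have I: "{1..m + 1} = insert (m + 1) {1..m}" by auto
      have same: "?p i = p i" if "i \<in> {1..m}" for i using that by simp
      have "inj_on p {1..m}" using p unfolding good_path_def by (elim conjE)
      then have "inj_on ?p {1..m}" using inj_on_cong[of "{1..m}" ?p p] same by simp
      moreover have img: "?p ` {1..m} = p ` {1..m}" by (rule image_cong[OF refl same])
      ultimately have "inj_on ?p {1..m + 1}" unfolding I using nw by (simp add: inj_on_insert)
      moreover have "?p ` {1..m + 1} \<subseteq> K"
        unfolding I image_insert img using p \<open>w \<in> K\<close> unfolding good_path_def by simp
      moreover have "good (?p i) (?p (i + 1))" if "1 \<le> i" "i < m + 1" for i
        using that w(1) good_path_edge[OF p, of i] by (cases "i = m") auto
      ultimately have "good_path ?p (m + 1)" using m2 unfolding good_path_def by simp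
      then show False using max by blast
    qed
    then obtain i where i: "1 \<le> i" "i \<le> m" "w = p i" by auto
    have "i \<noteq> m" "i \<noteq> m - 1" using i w \<open>w \<noteq> p m\<close> by auto
    have "i = 1"
    proof (rule ccontr)
      assume "i \<noteq> 1"
      have "good (p (i - 1)) (p (i - 1 + 1))" using i \<open>i \<noteq> 1\<close> by (intro good_path_edge[OF p]) auto
      then have "good (p i) (p (i - 1))" using i good_sym by simp
      moreover have "good (p i) (p (i + 1))" using i \<open>i \<noteq> m\<close> by (intro good_path_edge[OF p]) auto
      moreover have "good (p i) (p m)" using w i good_sym by blast
      moreover have "p (i - 1) \<noteq> p (i + 1)" "p m \<noteq> p (i - 1)" "p m \<noteq> p (i + 1)"
        using good_path_inj[OF p] i \<open>i \<noteq> 1\<close> \<open>i \<noteq> m\<close> \<open>i \<noteq> m - 1\<close> by auto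
      ultimately show False using good_degree(1) by blast
    qed
    then show ?thesis using i w m2 \<open>i \<noteq> m\<close> \<open>i \<noteq> m - 1\<close> by auto
  qed blast
qed

section \<open>Directions of the arcs along a path\<close>

lemma edge_flip: "u \<in> K \<Longrightarrow> v \<in> K \<Longrightarrow> u \<noteq> v \<Longrightarrow> E u v \<longleftrightarrow> \<not> E v u"
  using tournamentD[OF K_tournament] by blast

lemma no_uniform: "z \<in> K \<Longrightarrow> \<not> uniform E (K - {z}) z"
  using prime_no_uniform[OF K_prime _ K_card3] by blast

text \<open>The path neighbours of \<open>p (i + 1)\<close> are twins away from it but not in
  \<open>K\<close>, so \<open>p (i + 1)\<close> separates them: one arc enters it and the other
  leaves.\<close>

lemma good_path_consecutive:
  assumes p: "good_path p m" and i: "1 \<le> i" "i < m"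
  shows "E (p i) (p (i + 1)) \<longleftrightarrow> E (p 1) (p 2)"
  using i
proof (induction i rule: nat_induct_at_least)
  case (Suc i)
  have mem: "p i \<in> K" "p (i + 1) \<in> K" "p (i + 2) \<in> K"
    using good_path_mem[OF p] Suc by simp_all
  have ne: "p i \<noteq> p (i + 1)" "p i \<noteq> p (i + 2)" "p (i + 1) \<noteq> p (i + 2)"
    using good_path_inj[OF p] Suc by simp_all
  have "twins E (K - {p (i + 1)}) (p i) (p (i + 2))"
    using good_path_twins[OF p, of "i + 1"] Suc by simp
  moreover have "\<not> twins E K (p i) (p (i + 2))" using no_twins mem ne by simp
  ultimately have "E (p (i + 1)) (p i) \<noteq> E (p (i + 1)) (p (i + 2))"
    unfolding twins_def by blast
  then show ?case using Suc edge_flip[OF mem(1,2) ne(1)] by simp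
qed (simp add: numeral_2_eq_2)

text \<open>By the twin relation either end of a pair \<open>a < b\<close> can be moved by two as
  long as it does not pass the other end. This reduces every pair to one among the first four
  indices.\<close>

lemma good_path_zigzag:
  assumes p: "good_path p m" and e: "E (p 1) (p 2)"
  shows "zigzag E p m (E (p 2) (p 4)) (E (p 1) (p 3))"
proof -
  have mem: "p i \<in> K" if "1 \<le> i" "i \<le> m" for i using good_path_mem[OF p] that .
  have ne: "p i \<noteq> p j" if "1 \<le> i" "i \<le> m" "1 \<le> j" "j \<le> m" "i \<noteq> j" for i j
    using good_path_inj[OF p] that by simp
  have right: "E (p a) (p (b + 2)) \<longleftrightarrow> E (p a) (p b)" if "1 \<le> a" "a < b" "b + 2 \<le> m" for a b
  proof -
    have tw: "twins E (K - {p (b + 1)}) (p b) (p (b + 2))"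
      using good_path_twins[OF p, of "b + 1"] that by simp
    have "p a \<in> K - {p (b + 1)}" "p a \<noteq> p b" "p a \<noteq> p (b + 2)"
      using mem[of a] ne[of a b] ne[of a "b + 1"] ne[of a "b + 2"] that by auto
    from twinsD[OF tw this] show ?thesis by simp
  qed
  have left: "E (p (a + 2)) (p b) \<longleftrightarrow> E (p a) (p b)" if "1 \<le> a" "a + 2 < b" "b \<le> m" for a b
  proof -
    have tw: "twins E (K - {p (a + 1)}) (p a) (p (a + 2))"
      using good_path_twins[OF p, of "a + 1"] that by simp
    have d: "p b \<in> K - {p (a + 1)}" "p b \<noteq> p a" "p b \<noteq> p (a + 2)"
      using mem[of b] ne[of b a] ne[of b "a + 1"] ne[of b "a + 2"] that by auto
    have "E (p b) (p a) \<longleftrightarrow> E (p b) (p (a + 2))" by (rule twinsD[OF tw d])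
    then show ?thesis
      using edge_flip[of "p a" "p b"] edge_flip[of "p (a + 2)" "p b"] d mem[of a] mem[of "a + 2"] that by auto
  qed
  have "1 \<le> a \<Longrightarrow> a < b \<Longrightarrow> b \<le> m \<Longrightarrow>
     E (p a) (p b) \<longleftrightarrow> odd a \<noteq> odd b \<or> (if odd a then E (p 1) (p 3) else E (p 2) (p 4))" for a b
  proof (induction "a + b" arbitrary: a b rule: less_induct)
    case less
    consider "3 \<le> a" | "a + 3 \<le> b" "a \<le> 2" | "a \<le> 2" "b = a + 1 \<or> b = a + 2"
      using less.prems by linarith
    then show ?case
    proof cases
      case 1
      then have d: "a - 2 + b < a + b" "1 \<le> a - 2" "a - 2 < b" "a - 2 + 2 < b" "a - 2 + 2 = a" "odd (a - 2) = odd a"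
        using less.prems by auto
      have "E (p a) (p b) \<longleftrightarrow> E (p (a - 2)) (p b)"
        using left[OF d(2,4) less.prems(3)] unfolding d(5) .
      then show ?thesis using less.hyps[OF d(1-3) less.prems(3)] unfolding d(6) by (rule trans)
    next
      case 2
      then have d: "a + (b - 2) < a + b" "a < b - 2" "b - 2 \<le> m" "b - 2 + 2 \<le> m" "b - 2 + 2 = b" "odd (b - 2) = odd b"
        using less.prems by auto
      have "E (p a) (p b) \<longleftrightarrow> E (p a) (p (b - 2))"
        using right[OF less.prems(1) d(2,4)] unfolding d(5) .
      then show ?thesis using less.hyps[OF d(1) less.prems(1) d(2,3)] unfolding d(6) by (rule trans)
    next
      case 3
      then consider "a = 1" "b = 2" | "a = 1" "b = 3" | "a = 2" "b = 3" | "a = 2" "b = 4"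
        using less.prems by linarith
      then show ?thesis
      proof cases
        case 3
        then show ?thesis using e good_path_consecutive[OF p, of 2] less.prems by simp
      qed (use e in simp_all)
    qed
  qed
  then show ?thesis unfolding zigzag_def by blast
qed

text \<open>Path vertices two apart are twins for everything but the vertex between them, so
  \<open>r\<close> can only see the parity of an index.\<close>

lemma good_path_outside:
  assumes p: "good_path p m" and r: "r \<in> K" "r \<notin> p ` {1..m}" and i: "1 \<le> i" "i \<le> m"
  shows "E r (p i) \<longleftrightarrow> E r (p (if odd i then 1 else 2))"
  using i
proof (induction i rule: less_induct)
  case (less i)
  show ?case
  proof (cases "i \<le> 2")
    case True
    then have "i = 1 \<or> i = 2" using less.prems by linarith
    then show ?thesis by auto
  next
    case False
    have i: "i - 1 - 1 = i - 2" "i - 1 + 1 = i" "1 < i - 1" "i - 1 < m" using less.prems False by auto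
    have tw: "twins E (K - {p (i - 1)}) (p (i - 2)) (p i)"
      using good_path_twins[OF p i(3,4)] unfolding i(1,2) .
    have nr: "r \<noteq> p j" if "1 \<le> j" "j \<le> m" for j using r(2) that by auto
    have "E r (p (i - 2)) \<longleftrightarrow> E r (p i)"
      by (rule twinsD[OF tw]) (use r(1) nr[of "i - 1"] nr[of "i - 2"] nr[of i] less.prems False in auto)
    moreover have "E r (p (i - 2)) \<longleftrightarrow> E r (p (if odd (i - 2) then 1 else 2))"
      by (rule less.IH) (use less.prems False in auto)
    moreover have "odd (i - 2) = odd i" using False by simp
    ultimately show ?thesis by simp
  qed
qed

section \<open>Closed or uniform-ended paths and the shape of K\<close>

definition chain :: "(nat \<Rightarrow> 'a) \<Rightarrow> nat \<Rightarrow> bool" where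
  "chain p m \<longleftrightarrow> good_path p m \<and> (3 \<le> m \<and> good (p m) (p 1) \<or>
     uniform E (K - {p 1, p 2}) (p 2) \<and> uniform E (K - {p m, p (m - 1)}) (p (m - 1)))"

lemma chain_rev:
  assumes "chain p m"
  shows "chain (\<lambda>i. p (m + 1 - i)) m"
proof -
  have "good_path p m" using assms unfolding chain_def by (elim conjE)
  then have "2 \<le> m" unfolding good_path_def by (elim conjE)
  then have "m + 1 - 1 = m" "m + 1 - 2 = m - 1" "m + 1 - m = 1" "m + 1 - (m - 1) = 2" by auto
  then show ?thesis
    using assms good_path_rev[of p m] good_sym[of "p 1" "p m"] unfolding chain_def by auto
qed

lemma chain_exists: "\<exists>p m. chain p m \<and> E (p 1) (p 2)"
proof -
  obtain p m where p: "good_path p m" and max: "\<And>p'. \<not> good_path p' (m + 1)"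
    using maximal_good_path by blast
  have m: "2 \<le> m" using p unfolding good_path_def by (elim conjE)
  then have eqs: "m + 1 - 1 = m" "m + 1 - 2 = m - 1" "m + 1 - m = 1" "m + 1 - (m - 1) = 2" by auto
  have "chain p m"
    using p maximal_good_path_end[OF p max] maximal_good_path_end[OF good_path_rev[OF p] max] good_sym[of "p 1" "p m"]
    unfolding chain_def eqs by auto
  show ?thesis
  proof (cases "E (p 1) (p 2)")
    case True
    then show ?thesis using \<open>chain p m\<close> by blast
  next
    case False
    \<comment> \<open>All consecutive arcs have the same direction, so reversing the path makes the
      first one go forward.\<close>
    let ?q = "\<lambda>i. p (m + 1 - i)"
    have "\<not> E (p (m - 1)) (p m)"
      using False good_path_consecutive[OF p, of "m - 1"] m by simp
    then have "E (p m) (p (m - 1))"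
      using edge_flip[of "p m" "p (m - 1)"] good_path_mem[OF p, of m] good_path_mem[OF p, of "m - 1"]
        good_path_inj[OF p, of m "m - 1"] m by simp
    then have "E (?q 1) (?q 2)" unfolding eqs .
    then show ?thesis using chain_rev[OF \<open>chain p m\<close>] by blast
  qed
qed

text \<open>In the first alternative the bit \<open>ee\<close> remains free: it distinguishes U from
  T. The second alternative is W, with \<open>r\<close> as its last vertex.\<close>

lemma classification:
  obtains p m ee oo where "good_path p m" "zigzag E p m ee oo"
    "K = p ` {1..m} \<and> odd m \<and> \<not> oo \<or>
     (\<exists>r. r \<notin> p ` {1..m} \<and> K = insert r (p ` {1..m}) \<and> even m \<and> ee \<and> oo \<and>
        (\<forall>a\<in>{1..m}. E (p a) r \<longleftrightarrow> even a))"
proof -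
  obtain p m where c: "chain p m" and e: "E (p 1) (p 2)" using chain_exists by blast
  have p: "good_path p m" using c unfolding chain_def by (elim conjE)
  have m2: "2 \<le> m" using p unfolding good_path_def by (elim conjE)
  \<comment> \<open>For small \<open>m\<close> the two bits may read indices beyond the path; they
    are then arbitrary but constrain no pair of path vertices.\<close>
  define ee where "ee = E (p 2) (p 4)"
  define oo where "oo = E (p 1) (p 3)"
  have z: "zigzag E p m ee oo" unfolding ee_def oo_def by (rule good_path_zigzag[OF p e])
  let ?C = "p ` {1..m}"
  have sub: "?C \<subseteq> K" using good_path_mem[OF p] by auto
  have cardC: "card ?C = m" using p unfolding good_path_def by (simp add: card_image)
  have mem: "p i \<in> K" if "1 \<le> i" "i \<le> m" for i using good_path_mem[OF p] that .
  have ne: "p i \<noteq> p j" if "1 \<le> i" "i \<le> m" "1 \<le> j" "j \<le> m" "i \<noteq> j" for i j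
    using good_path_inj[OF p] that by simp
  have n21: "\<not> E (p 2) (p 1)" using e edge_flip[of "p 1" "p 2"] mem[of 1] mem[of 2] ne[of 1 2] m2 by simp
  have not_top: "\<not> (\<forall>i. 2 \<le> i \<and> i \<le> m \<longrightarrow> E (p 1) (p i))" if "K = ?C"
  proof
    assume a: "\<forall>i. 2 \<le> i \<and> i \<le> m \<longrightarrow> E (p 1) (p i)"
    have "E (p 1) x" if x: "x \<in> K - {p 1}" for x
    proof -
      obtain i where "1 \<le> i" "i \<le> m" "x = p i" using x \<open>K = ?C\<close> by auto
      moreover then have "i \<noteq> 1" using x by auto
      ultimately show ?thesis using a by auto
    qed
    then have "uniform E (K - {p 1}) (p 1)" unfolding uniform_def by blast
    then show False using no_uniform mem[of 1] m2 by simp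
  qed
  have "K = ?C \<and> odd m \<and> \<not> oo \<or>
     (\<exists>r. r \<notin> ?C \<and> K = insert r ?C \<and> even m \<and> ee \<and> oo \<and> (\<forall>a\<in>{1..m}. E (p a) r \<longleftrightarrow> even a))"
  proof (cases "3 \<le> m \<and> good (p m) (p 1)")
    case True
    then have m3: "3 \<le> m" and g: "good (p m) (p 1)" by auto
    have "good (p (m - 1)) (p (m - 1 + 1))" using m3 by (intro good_path_edge[OF p]) auto
    then have g': "good (p m) (p (m - 1))" using m3 good_sym by simp
    \<comment> \<open>Closing up makes \<open>p (m - 1)\<close> and \<open>p 1\<close> twins around
      \<open>p m\<close>. This decides the parity of \<open>m\<close>, the homogeneity of the path
      and the bit \<open>oo\<close>.\<close>
    have tw: "twins E (K - {p m}) (p (m - 1)) (p 1)"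
      using good_degree(2)[OF g' g g] ne[of "m - 1" 1] m3 by simp
    have "odd m"
    proof
      assume "even m"
      then have m4: "4 \<le> m" using m3 by (cases "m = 3") auto
      have "E (p 2) (p (m - 1)) \<longleftrightarrow> E (p 2) (p 1)"
        by (rule twinsD[OF tw]) (use mem[of 2] ne[of 2 m] ne[of 2 "m - 1"] ne[of 2 1] m4 in auto)
      moreover have "E (p 2) (p (m - 1))" using zigzagD[OF z, of 2 "m - 1"] m4 \<open>even m\<close> by simp
      ultimately show False using n21 by simp
    qed
    have "homogeneous K E ?C"
      unfolding homogeneous_def
    proof (intro conjI ballI sub)
      fix r assume r: "r \<in> K - ?C"
      have out: "E r (p i) \<longleftrightarrow> E r (p (if odd i then 1 else 2))" if "1 \<le> i" "i \<le> m" for i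
        using good_path_outside[OF p _ _ that] r by blast
      have "E r (p (m - 1)) \<longleftrightarrow> E r (p 1)"
        by (rule twinsD[OF tw]) (use r m3 in auto)
      \<comment> \<open>\<open>m - 1\<close> is even, so what \<open>r\<close> sees at odd and at
        even indices coincides.\<close>
      then have "E r (p 2) \<longleftrightarrow> E r (p 1)" using out[of "m - 1"] \<open>odd m\<close> m3 by simp
      then have all: "E r (p i) \<longleftrightarrow> E r (p 1)" if "1 \<le> i" "i \<le> m" for i using out[OF that] by simp
      have "r \<noteq> p i" if "1 \<le> i" "i \<le> m" for i using r that by auto
      then have all': "E (p i) r \<longleftrightarrow> \<not> E r (p 1)" if "1 \<le> i" "i \<le> m" for i
        using all[OF that] edge_flip[of r "p i"] mem[OF that] r that by simp
      show "(\<forall>x\<in>?C. E r x) \<or> (\<forall>x\<in>?C. E x r)"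
      proof (cases "E r (p 1)")
        case True
        then have "\<forall>x\<in>?C. E r x" by (metis all atLeastAtMost_iff imageE)
        then show ?thesis ..
      next
        case False
        then have "\<forall>x\<in>?C. E x r" by (metis all' atLeastAtMost_iff imageE)
        then show ?thesis ..
      qed
    qed
    then have KC: "K = ?C" using prime_homogeneous[OF K_prime] cardC m2 by force
    then have m7: "7 \<le> m" using cardC K_card n5 by simp
    have "E (p 3) (p (m - 1)) \<longleftrightarrow> E (p 3) (p 1)"
      by (rule twinsD[OF tw]) (use mem[of 3] ne[of 3 m] ne[of 3 "m - 1"] ne[of 3 1] m7 in auto)
    moreover have "E (p 3) (p (m - 1))" using zigzagD[OF z, of 3 "m - 1"] m7 \<open>odd m\<close> by simp
    ultimately have "\<not> oo"
      using edge_flip[of "p 1" "p 3"] mem[of 1] mem[of 3] ne[of 1 3] m7 unfolding oo_def by simp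
    then show ?thesis using KC \<open>odd m\<close> by blast
  next
    case False
    then have u: "uniform E (K - {p 1, p 2}) (p 2)" "uniform E (K - {p m, p (m - 1)}) (p (m - 1))"
      using c unfolding chain_def by auto
    \<comment> \<open>\<open>p 1\<close> dominates \<open>p 2\<close>; if all other vertices did
      too, \<open>p 2\<close> would be uniform over \<open>K - {p 2}\<close>. So its uniform
      direction is outward, and dually it is inward for \<open>p (m - 1)\<close>.\<close>
    have src: "E (p 2) x" if "x \<in> K" "x \<noteq> p 1" "x \<noteq> p 2" for x
    proof (rule ccontr)
      assume "\<not> E (p 2) x"
      then have "\<forall>x\<in>K - {p 1, p 2}. E x (p 2)" using u(1) that unfolding uniform_def by blast
      then have "uniform E (K - {p 2}) (p 2)" using e unfolding uniform_def by blast
      then show False using no_uniform mem[of 2] m2 by simp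
    qed
    have em: "E (p (m - 1)) (p m)" using e good_path_consecutive[OF p, of "m - 1"] m2 by simp
    have snk: "E x (p (m - 1))" if "x \<in> K" "x \<noteq> p m" "x \<noteq> p (m - 1)" for x
    proof (rule ccontr)
      assume "\<not> E x (p (m - 1))"
      then have "\<forall>x\<in>K - {p m, p (m - 1)}. E (p (m - 1)) x" using u(2) that unfolding uniform_def by blast
      then have "uniform E (K - {p (m - 1)}) (p (m - 1))" using em unfolding uniform_def by blast
      then show False using no_uniform mem[of "m - 1"] m2 by simp
    qed
    have "m \<noteq> 2"
    proof
      assume m: "m = 2"
      \<comment> \<open>For \<open>m = 2\<close>, \<open>p 2\<close> dominates the rest and the rest
        dominates \<open>p 1\<close>.\<close>
      have "homogeneous K E (K - {p 1, p 2})"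
        unfolding homogeneous_def using src snk m by auto
      then have "K - {p 1, p 2} = K \<or> card (K - {p 1, p 2}) \<le> 1" by (rule prime_homogeneous[OF K_prime])
      moreover have "card (K - {p 1, p 2}) = n"
        using mem[of 1] mem[of 2] ne[of 1 2] m K_card K_finite by (simp add: card_Diff_subset)
      ultimately show False using n5 mem[of 1] m by auto
    qed
    moreover have "m \<noteq> 3"
    proof
      assume m: "m = 3"
      have "K \<noteq> ?C" using cardC K_card n5 m by auto
      then obtain x where x: "x \<in> K" "x \<notin> ?C" using sub by blast
      have "x \<noteq> p i" if "1 \<le> i" "i \<le> m" for i using x(2) that by auto
      then have "E (p 2) x" "E x (p 2)" using src[of x] snk[of x] x m by auto
      then show False using edge_flip[of x "p 2"] x mem[of 2] \<open>\<And>i. 1 \<le> i \<Longrightarrow> i \<le> m \<Longrightarrow> x \<noteq> p i\<close>[of 2] m by simp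
    qed
    ultimately have m4: "4 \<le> m" using m2 by linarith
    have ee unfolding ee_def using src[of "p 4"] mem[of 4] ne[of 4 1] ne[of 4 2] m4 by simp
    have out: "E r (p i) \<longleftrightarrow> E r (p (if odd i then 1 else 2))" if "1 \<le> i" "i \<le> m" "r \<in> K" "r \<notin> ?C" for i r
      using good_path_outside[OF p] that by blast
    have rne: "r \<noteq> p i" if "1 \<le> i" "i \<le> m" "r \<notin> ?C" for i r using that by auto
    have r2: "\<not> E r (p 2)" if "r \<in> K" "r \<notin> ?C" for r
      using src[of r] edge_flip[of r "p 2"] mem[of 2] rne[of 1 r] rne[of 2 r] that m4 by simp
    have rm: "E r (p (m - 1))" if "r \<in> K" "r \<notin> ?C" for r
      using snk[of r] rne[of m r] rne[of "m - 1" r] that m4 by simp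
    show ?thesis
    proof (cases "odd m")
      case True
      have "K = ?C"
      proof (rule ccontr)
        assume "K \<noteq> ?C"
        then obtain r where r: "r \<in> K" "r \<notin> ?C" using sub by blast
        \<comment> \<open>A vertex off the path loses to \<open>p 2\<close> but beats
          \<open>p (m - 1)\<close>, though both indices are even.\<close>
        have "1 \<le> m - 1" "m - 1 \<le> m" "\<not> odd (m - 1)" using m4 True by auto
        then show False using r2[OF r] rm[OF r] out[OF _ _ r, of "m - 1"] by simp
      qed
      moreover have "\<not> oo"
      proof
        assume oo
        then have "E (p 1) (p i)" if "2 \<le> i" "i \<le> m" for i using zigzagD[OF z, of 1 i] that by simp
        then show False using not_top[OF \<open>K = ?C\<close>] by blast
      qed
      ultimately show ?thesis using True by blast
    next
      case False
      have "E (p 1) (p (m - 1))" using snk[of "p 1"] mem[of 1] ne[of 1 m] ne[of 1 "m - 1"] m4 by simp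
      then have oo using zigzagD[OF z, of 1 "m - 1"] m4 False by simp
      have pr: "E r (p i) \<longleftrightarrow> odd i" if "1 \<le> i" "i \<le> m" "r \<in> K" "r \<notin> ?C" for i r
        using out[OF that] out[of "m - 1" r] rm[OF that(3,4)] r2[OF that(3,4)] that m4 False by auto
      have pr': "E (p i) r \<longleftrightarrow> even i" if "1 \<le> i" "i \<le> m" "r \<in> K" "r \<notin> ?C" for i r
        using pr[OF that] edge_flip[of r "p i"] mem[of i] rne[of i r] that by simp
      \<comment> \<open>All vertices off the path have the same arcs to it, so primality allows at
        most one; with none, \<open>p 1\<close> would dominate everything.\<close>
      have "homogeneous K E (K - ?C)"
        unfolding homogeneous_def using pr pr' by auto
      then have "K - ?C = K \<or> card (K - ?C) \<le> 1" by (rule prime_homogeneous[OF K_prime])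
      moreover have "p 1 \<in> ?C" "p 1 \<in> K" using mem[of 1] m4 by simp_all
      ultimately have le1: "card (K - ?C) \<le> 1" by (metis DiffD2)
      have "K \<noteq> ?C"
      proof
        assume "K = ?C"
        have "E (p 1) (p i)" if "2 \<le> i" "i \<le> m" for i using zigzagD[OF z, of 1 i] \<open>oo\<close> that by simp
        then show False using not_top[OF \<open>K = ?C\<close>] by blast
      qed
      then obtain r where r: "r \<in> K" "r \<notin> ?C" using sub by blast
      then have "K - ?C = {r}" using le1 K_finite by (intro eq_singleton_if_card_le_1) auto
      then have "K = insert r ?C" using sub r by blast
      then show ?thesis using r False \<open>ee\<close> \<open>oo\<close> pr'[OF _ _ r] by auto
    qed
  qed
  then show ?thesis using that p z by blast
qed

end

section \<open>One-vertex extensions of zigzag tournaments\<close>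

text \<open>The index \<open>j\<close> is exempt because \<open>p j\<close> is not compared with
  itself when twins of it are tested; either value of \<open>h j\<close> fits a final
  segment.\<close>

lemma ascending_except:
  assumes "\<And>a. a \<in> S \<Longrightarrow> a \<noteq> j \<Longrightarrow> h a \<longleftrightarrow> j < a"
  shows "ascending h S"
  unfolding ascending_def
proof (intro ballI impI)
  fix i k assume "i \<in> S" "k \<in> S" "i < k \<and> h i"
  then show "h k" using assms[of i] assms[of k] by (cases "i = j"; cases "k = j") auto
qed

text \<open>Since \<open>j\<close> is exempt, the threshold may be moved from an even
  \<open>a\<close> to \<open>a + 1\<close>; \<open>odd m\<close> keeps this within range.\<close>

lemma threshold_choice:
  fixes a m :: nat
  assumes "\<And>i. i \<in> {1..m} \<Longrightarrow> h i \<longleftrightarrow> a < i" and "odd m" "a \<le> m"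
  obtains j where "j \<in> {1..m}" "odd j" "\<And>i. i \<in> {1..m} \<Longrightarrow> i \<noteq> j \<Longrightarrow> h i \<longleftrightarrow> j < i"
proof -
  define j where "j = (if odd a then a else a + 1)"
  have "a < m" if "even a" using assms(2,3) that by (cases "a = m") auto
  then have "j \<in> {1..m}" using assms(3) odd_pos[of a] unfolding j_def by auto
  moreover have "odd j" by (simp add: j_def)
  moreover have "h i \<longleftrightarrow> j < i" if "i \<in> {1..m}" "i \<noteq> j" for i
    using assms(1)[OF that(1)] that by (auto simp: j_def split: if_splits)
  ultimately show ?thesis using that by blast
qed

text \<open>Deleting either pair leaves the triple intact, and on such a triple a constant function
  twisted by parity alternates, hence is not ascending.\<close>

lemma alternating_triple:
  fixes i m :: nat
  assumes "1 \<le> i" "i < m" "7 \<le> m"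
  obtains i' x y w where "1 \<le> i'" "i' < m" "1 \<le> x" "x < y" "y < w" "w \<le> m" "odd x \<noteq> odd y" "odd y \<noteq> odd w"
    "{i, i + 1} \<inter> {i', i' + 1} = {}" "{i, i + 1, i', i' + 1} \<inter> {x, y, w} = {}"
proof -
  consider "i = 1" | "i = 2" | "i = 3" | "i = 4" | "i = 5" | "6 \<le> i" using assms by linarith
  then show ?thesis
  proof cases
    case 1
    then show ?thesis using that[of 6 3 4 5] assms by simp
  next
    case 2
    then show ?thesis using that[of 6 1 4 5] assms by simp
  next
    case 3
    then show ?thesis using that[of 1 5 6 7] assms by simp
  next
    case 4
    then show ?thesis using that[of 1 3 6 7] assms by simp
  next
    case 5
    then show ?thesis using that[of 1 3 4 7] assms by simp
  next
    case 6
    then show ?thesis using that[of 1 3 4 5] assms by simp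
  qed
qed

lemma twins_out:
  assumes "tournament V E" "X \<subseteq> V" "c \<in> V" "z \<in> V"
  shows "twins E X c z \<longleftrightarrow> (\<forall>v\<in>X - {c, z}. E c v \<longleftrightarrow> E z v)"
proof -
  have "(E v c \<longleftrightarrow> E v z) \<longleftrightarrow> (E c v \<longleftrightarrow> E z v)" if "v \<in> X - {c, z}" for v
    using tournamentD[OF assms(1), of v c] tournamentD[OF assms(1), of v z] assms that by auto
  then show ?thesis unfolding twins_def by blast
qed

context stuck_pair
begin

lemma no_extension:
  assumes z: "z \<in> V - K"
  shows "\<not> prime_tournament (insert z K) E"
proof
  assume pr: "prime_tournament (insert z K) E"
  have notU: "\<not> uniform E K z" using nonprime_uniform[OF _ K_card3] z pr by blast
  have "\<not> twins E K c z" if "c \<in> K" for c using nonprime_twins[OF that _ K_card3] z pr by blast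
  then have notT: "\<exists>v\<in>K. v \<noteq> c \<and> E c v \<noteq> E z v" if "c \<in> K" for c
    using twins_out[OF V_tournament K_sub, of c z] that K_sub z by blast
  have out: "E x z \<longleftrightarrow> \<not> E z x" if "x \<in> K" for x
    using tournamentD[OF V_tournament, of x z] that K_sub z by blast
  obtain p m ee oo where p: "good_path p m" and zz: "zigzag E p m ee oo" and
    cl: "K = p ` {1..m} \<and> odd m \<and> \<not> oo \<or>
     (\<exists>r. r \<notin> p ` {1..m} \<and> K = insert r (p ` {1..m}) \<and> even m \<and> ee \<and> oo \<and>
        (\<forall>a\<in>{1..m}. E (p a) r \<longleftrightarrow> even a))"
    by (rule classification)
  have sub: "p ` {1..m} \<subseteq> K" using p unfolding good_path_def by (elim conjE)
  have inj: "inj_on p {1..m}" using p unfolding good_path_def by (elim conjE)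
  have cardC: "card (p ` {1..m}) = m" using inj by (simp add: card_image)
  have mem: "p i \<in> K" if "i \<in> {1..m}" for i using sub that by blast
  have ne: "p i \<noteq> p j" if "i \<in> {1..m}" "j \<in> {1..m}" "i \<noteq> j" for i j
    using inj that by (meson inj_onD)
  have edge: "E (p a) (p b) \<longleftrightarrow> (if a < b then odd a \<noteq> odd b \<or> (if odd a then oo else ee)
     else a \<noteq> b \<and> \<not> (odd a \<noteq> odd b \<or> (if odd a then oo else ee)))" if "a \<in> {1..m}" "b \<in> {1..m}" for a b
    by (rule zigzag_edge[OF zz K_tournament inj sub that])
  define f where "f a = E z (p a)" for a
  define S where "S i = {1..m} - {i, i + 1}" for i
  have S_mem: "p a \<in> K - {p i, p (i + 1)}" if "a \<in> S i" "1 \<le> i" "i < m" for a i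
    using mem[of a] ne[of a i] ne[of a "i + 1"] that by (auto simp: S_def)
  have class_of: "uniform E (K - {p i, p (i + 1)}) z \<or>
      (\<exists>c\<in>K - {p i, p (i + 1)}. \<forall>v\<in>K - {p i, p (i + 1)}. v \<noteq> c \<longrightarrow> (E c v \<longleftrightarrow> E z v))"
    if i: "1 \<le> i" "i < m" for i
  proof -
    let ?X = "K - {p i, p (i + 1)}"
    have X: "?X \<in> Q" using good_path_edge[OF p i] unfolding good_def by (elim conjE)
    have zX: "z \<in> V - ?X" "z \<notin> ?X" "?X \<subseteq> V" using z K_sub by auto
    have "E c v \<longleftrightarrow> E z v" if "c \<in> ?X" "twins E ?X c z" "v \<in> ?X" "v \<noteq> c" for c v
    proof -
      have "c \<in> V" "z \<in> V" using that(1) zX z by auto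
      then have "\<forall>v\<in>?X - {c, z}. E c v \<longleftrightarrow> E z v"
        using twins_out[OF V_tournament zX(3)] that(2) by simp
      moreover have "v \<in> ?X - {c, z}" using that zX(2) by auto
      ultimately show ?thesis by (rule bspec)
    qed
    then show ?thesis using Q_cases[OF X zX(1)] by metis
  qed
  have const: "(\<forall>a\<in>S i. f a) \<or> (\<forall>a\<in>S i. \<not> f a)"
    if "uniform E (K - {p i, p (i + 1)}) z" "1 \<le> i" "i < m" for i
  proof -
    have "(\<forall>a\<in>S i. E z (p a)) \<or> (\<forall>a\<in>S i. E (p a) z)"
      using that(1) S_mem[OF _ that(2,3)] unfolding uniform_def by blast
    then show ?thesis using out mem unfolding f_def S_def by blast
  qed
  show False
    using cl
  proof
    assume T: "K = p ` {1..m} \<and> odd m \<and> \<not> oo"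
    then have KC: "K = p ` {1..m}" and m: "odd m" and oo: "\<not> oo" by auto
    have m7: "7 \<le> m" using cardC KC K_card n5 by simp
    \<comment> \<open>Twisted so that, by \<open>clone\<close> below, \<open>z\<close> behaves like
      \<open>p j\<close> exactly when \<open>h1\<close> (for even \<open>j\<close>) or
      \<open>h2\<close> (for odd \<open>j\<close>) is the threshold function at
      \<open>j\<close>.\<close>
    define h1 where "h1 a \<longleftrightarrow> (if ee then f a else f a \<noteq> even a)" for a
    define h2 where "h2 a \<longleftrightarrow> f a \<noteq> odd a" for a
    have clone: "(E (p j) (p a) \<longleftrightarrow> f a) \<longleftrightarrow> (if even j then h1 a \<longleftrightarrow> j < a else h2 a \<longleftrightarrow> j < a)"
      if "a \<in> {1..m}" "j \<in> {1..m}" "a \<noteq> j" for a j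
      using edge[OF that(2,1)] that(3) oo unfolding h1_def h2_def by auto
    have clash: "\<exists>a\<in>{1..m}. a \<noteq> j \<and> E (p j) (p a) \<noteq> f a" if j: "j \<in> {1..m}" for j
    proof -
      obtain v where v: "v \<in> K" "v \<noteq> p j" "E (p j) v \<noteq> E z v" using notT[OF mem[OF j]] by blast
      then obtain a where "a \<in> {1..m}" "v = p a" using KC by blast
      then show ?thesis using v unfolding f_def by (intro bexI[of _ a]) auto
    qed
    have not_const: "\<not> (\<forall>a\<in>{1..m}. f a)" "\<not> (\<forall>a\<in>{1..m}. \<not> f a)"
      using notU out KC unfolding uniform_def f_def by auto
    have cls: "uniform E (K - {p i, p (i + 1)}) z \<or> ascending h1 (S i) \<or> ascending h2 (S i)"
      if i: "1 \<le> i" "i < m" for i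
      using class_of[OF i]
    proof
      assume "\<exists>c\<in>K - {p i, p (i + 1)}. \<forall>v\<in>K - {p i, p (i + 1)}. v \<noteq> c \<longrightarrow> (E c v \<longleftrightarrow> E z v)"
      then obtain j where j: "j \<in> {1..m}"
        and cj: "\<And>v. v \<in> K - {p i, p (i + 1)} \<Longrightarrow> v \<noteq> p j \<Longrightarrow> E (p j) v \<longleftrightarrow> E z v"
        using KC by blast
      have "if even j then h1 a \<longleftrightarrow> j < a else h2 a \<longleftrightarrow> j < a" if a: "a \<in> S i" "a \<noteq> j" for a
      proof -
        have "a \<in> {1..m}" using a by (simp add: S_def)
        moreover have "E (p j) (p a) \<longleftrightarrow> f a"
          unfolding f_def using cj[OF S_mem[OF a(1) i]] ne[OF _ j a(2)] \<open>a \<in> {1..m}\<close> by blast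
        ultimately show ?thesis using clone[OF _ j a(2)] by blast
      qed
      then show ?thesis using ascending_except[of "S i" j h1] ascending_except[of "S i" j h2] by metis
    qed blast
    have "ascending h1 (S i) \<or> ascending h2 (S i)" if i: "1 \<le> i" "i < m" for i
    proof (cases ee)
      case True
      then have "h1 = f" by (simp add: h1_def fun_eq_iff)
      then show ?thesis using cls[OF i] const[OF _ i] unfolding ascending_def by metis
    next
      case False
      \<comment> \<open>Without \<open>ee\<close> both functions are twisted, so a constant
        \<open>f\<close> is not ascending. If \<open>z\<close> is uniform after deleting the pair at
        \<open>i\<close>, an alternating triple forces it to be uniform after deleting a disjoint
        pair too, and together these make \<open>f\<close> constant.\<close>
      show ?thesis
      proof (rule ccontr)
        assume "\<not> ?thesis"
        then have "uniform E (K - {p i, p (i + 1)}) z" using cls[OF i] by blast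
        from const[OF this i] obtain b where b: "\<And>a. a \<in> S i \<Longrightarrow> f a = b" by blast
        obtain i' x y w where i': "1 \<le> i'" "i' < m" and xyw: "1 \<le> x" "x < y" "y < w" "w \<le> m"
          "odd x \<noteq> odd y" "odd y \<noteq> odd w"
          and dis: "{i, i + 1} \<inter> {i', i' + 1} = {}" "{i, i + 1, i', i' + 1} \<inter> {x, y, w} = {}"
          by (rule alternating_triple[OF i m7])
        have inS: "x \<in> S i" "y \<in> S i" "w \<in> S i" "x \<in> S i'" "y \<in> S i'" "w \<in> S i'"
          using xyw(1-4) dis(2) unfolding S_def by simp_all
        have fb: "f x = b" "f y = b" "f w = b" using b inS by blast+
        have alt: "\<not> ascending h (S i')" if "h x \<noteq> h y" "h y \<noteq> h w" for h
          using ascendingD[of h "S i'" x y] ascendingD[of h "S i'" y w] inS(4-6) xyw(2,3) that by blast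
        have "\<not> ascending h1 (S i')"
          by (rule alt) (use fb xyw(5,6) False in \<open>auto simp: h1_def\<close>)
        moreover have "\<not> ascending h2 (S i')"
          by (rule alt) (use fb xyw(5,6) in \<open>auto simp: h2_def\<close>)
        ultimately have "uniform E (K - {p i', p (i' + 1)}) z" using cls[OF i'] by blast
        from const[OF this i'] have b': "f a = b" if "a \<in> S i'" for a
          using that inS(4) fb(1) by metis
        have "f a = b" if "a \<in> {1..m}" for a
        proof -
          have "a \<in> S i \<or> a \<in> S i'" using that dis(1) by (auto simp: S_def)
          then show ?thesis using b b' by blast
        qed
        then show False using not_const by metis
      qed
    qed
    moreover have "h1 3 \<noteq> h2 3" by (simp add: h1_def h2_def)
    ultimately have "ascending h1 {1..m} \<or> ascending h2 {1..m}"
      using ascending_local2[OF m7, of h1 h2] unfolding S_def by blast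
    moreover have no2: "\<not> (\<forall>a\<in>{1..m}. a \<noteq> j \<longrightarrow> (h2 a \<longleftrightarrow> j < a))" if "j \<in> {1..m}" "odd j" for j
    proof
      assume "\<forall>a\<in>{1..m}. a \<noteq> j \<longrightarrow> (h2 a \<longleftrightarrow> j < a)"
      then have "E (p j) (p a) \<longleftrightarrow> f a" if "a \<in> {1..m}" "a \<noteq> j" for a
        using clone[OF that(1) \<open>j \<in> {1..m}\<close> that(2)] \<open>odd j\<close> that by simp
      then show False using clash[OF that(1)] by blast
    qed
    moreover have no1: "\<not> (\<forall>a\<in>{1..m}. a \<noteq> j \<longrightarrow> (h1 a \<longleftrightarrow> j < a))" if "j \<in> {1..m}" "even j" for j
    proof
      assume "\<forall>a\<in>{1..m}. a \<noteq> j \<longrightarrow> (h1 a \<longleftrightarrow> j < a)"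
      then have "E (p j) (p a) \<longleftrightarrow> f a" if "a \<in> {1..m}" "a \<noteq> j" for a
        using clone[OF that(1) \<open>j \<in> {1..m}\<close> that(2)] \<open>even j\<close> that by simp
      then show False using clash[OF that(1)] by blast
    qed
    ultimately have asc1: "ascending h1 {1..m}"
    proof -
      \<comment> \<open>A threshold of \<open>h2\<close> can be placed at an odd \<open>j\<close>,
        making \<open>z\<close> a twin of \<open>p j\<close>.\<close>
      have "\<not> ascending h2 {1..m}"
      proof
        assume "ascending h2 {1..m}"
        then obtain a where a: "a \<le> m" "\<And>i. i \<in> {1..m} \<Longrightarrow> h2 i \<longleftrightarrow> a < i"
          by (rule ascending_threshold) blast
        obtain j where "j \<in> {1..m}" "odd j" "\<And>i. i \<in> {1..m} \<Longrightarrow> i \<noteq> j \<Longrightarrow> h2 i \<longleftrightarrow> j < i"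
          by (rule threshold_choice[OF a(2) m a(1)]) blast+
        then show False using no2 by blast
      qed
      then show ?thesis using \<open>ascending h1 {1..m} \<or> ascending h2 {1..m}\<close> by blast
    qed
    obtain a where a: "a \<le> m" "\<And>i. i \<in> {1..m} \<Longrightarrow> h1 i \<longleftrightarrow> a < i"
      by (rule ascending_threshold[OF asc1]) blast
    \<comment> \<open>No even \<open>j\<close> in range fits the thresholds 0 and \<open>m\<close>.
      There \<open>f\<close> is constant if \<open>ee\<close> holds; otherwise \<open>h2\<close> is
      constant and \<open>z\<close> is a twin of \<open>p m\<close> or \<open>p 1\<close>.\<close>
    consider "a = 0" | "a = m" | "1 \<le> a" "a < m" using a(1) by linarith
    then show False
    proof cases
      case 1
      then have h: "h1 i" if "i \<in> {1..m}" for i using a(2)[OF that] that by simp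
      show False
      proof (cases ee)
        case True
        then show False using h not_const(1) by (simp add: h1_def)
      next
        case False
        then have "\<not> h2 i" if "i \<in> {1..m}" for i using h[OF that] by (auto simp: h1_def h2_def)
        then show False using no2[of m] m m7 by auto
      qed
    next
      case 2
      then have h: "\<not> h1 i" if "i \<in> {1..m}" for i using a(2)[OF that] that by simp
      show False
      proof (cases ee)
        case True
        then show False using h not_const(2) by (simp add: h1_def)
      next
        case False
        then have "h2 i" if "i \<in> {1..m}" for i using h[OF that] by (auto simp: h1_def h2_def)
        then show False using no2[of 1] m7 by auto
      qed
    next
      case 3
      define j where "j = (if even a then a else a + 1)"
      have "j \<in> {1..m}" "even j" using 3 by (auto simp: j_def)
      moreover have "h1 i \<longleftrightarrow> j < i" if "i \<in> {1..m}" "i \<noteq> j" for i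
        using a(2)[OF that(1)] that(2) by (auto simp: j_def split: if_splits)
      ultimately show False using no1 by blast
    qed
  next
    assume "\<exists>r. r \<notin> p ` {1..m} \<and> K = insert r (p ` {1..m}) \<and> even m \<and> ee \<and> oo \<and>
        (\<forall>a\<in>{1..m}. E (p a) r \<longleftrightarrow> even a)"
    then obtain r where r: "r \<notin> p ` {1..m}" "K = insert r (p ` {1..m})" and m: "even m" and ee: ee and oo: oo
      and er: "\<And>a. a \<in> {1..m} \<Longrightarrow> E (p a) r \<longleftrightarrow> even a" by blast
    have m6: "6 \<le> m" using cardC r K_card n5 by simp
    have rp: "r \<noteq> p a" if "a \<in> {1..m}" for a using r(1) that by blast
    have re: "E r (p a) \<longleftrightarrow> odd a" if "a \<in> {1..m}" for a
      using er[OF that] edge_flip[of r "p a"] rp[OF that] mem[OF that] r(2) by simp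
    have clone: "E (p j) (p a) \<longleftrightarrow> j < a" if "a \<in> {1..m}" "j \<in> {1..m}" "a \<noteq> j" for a j
      using edge[OF that(2,1)] that(3) ee oo by auto
    have not_r: "\<not> (\<forall>a\<in>{1..m}. f a \<longleftrightarrow> odd a)"
      using notT[of r] r(2) re unfolding f_def by auto
    have not_p: "\<not> (\<forall>a\<in>{1..m}. a \<noteq> j \<longrightarrow> (f a \<longleftrightarrow> j < a))" if j: "j \<in> {1..m}" "E z r \<longleftrightarrow> even j" for j
    proof -
      obtain v where v: "v \<in> K" "v \<noteq> p j" "E (p j) v \<noteq> E z v" using notT[OF mem[OF j(1)]] by blast
      then have "v \<noteq> r" using er[OF j(1)] j(2) by blast
      then obtain a where "a \<in> {1..m}" "v = p a" using v(1) r(2) by blast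
      moreover have "a \<noteq> j" using v(2) \<open>v = p a\<close> by blast
      ultimately show ?thesis using v(3) clone[OF _ j(1), of a] unfolding f_def by blast
    qed
    \<comment> \<open>The arc between \<open>z\<close> and \<open>r\<close> is ignored here;
      afterwards it fixes the parity of \<open>j\<close>.\<close>
    have "ascending f (S i) \<or> (\<forall>a\<in>S i. f a \<longleftrightarrow> odd a)" if i: "1 \<le> i" "i < m" for i
      using class_of[OF i]
    proof
      assume "uniform E (K - {p i, p (i + 1)}) z"
      from const[OF this i] show ?thesis unfolding ascending_def by blast
    next
      assume "\<exists>c\<in>K - {p i, p (i + 1)}. \<forall>v\<in>K - {p i, p (i + 1)}. v \<noteq> c \<longrightarrow> (E c v \<longleftrightarrow> E z v)"
      then obtain c where c: "c \<in> K"
        and cv: "\<And>v. v \<in> K - {p i, p (i + 1)} \<Longrightarrow> v \<noteq> c \<Longrightarrow> E c v \<longleftrightarrow> E z v" by blast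
      have fc: "f a \<longleftrightarrow> E c (p a)" if "a \<in> S i" "p a \<noteq> c" for a
        using cv[OF S_mem[OF that(1) i] that(2)] by (simp add: f_def)
      have S: "a \<in> {1..m}" if "a \<in> S i" for a using that by (simp add: S_def)
      show ?thesis
      proof (cases "c = r")
        case True
        then show ?thesis using fc re S rp by metis
      next
        case False
        then obtain j where j: "j \<in> {1..m}" "c = p j" using c r(2) by blast
        then have "f a \<longleftrightarrow> j < a" if "a \<in> S i" "a \<noteq> j" for a
          using fc[OF that(1)] ne[OF S[OF that(1)] j(1) that(2)] clone[OF S[OF that(1)] j(1) that(2)] by simp
        then show ?thesis using ascending_except[of "S i" j f] by blast
      qed
    qed
    then have "ascending f {1..m}"
      using ascending_local1[OF m6, of f] not_r unfolding S_def by blast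
    then obtain a where a: "a \<le> m" "\<And>i. i \<in> {1..m} \<Longrightarrow> f i \<longleftrightarrow> a < i"
      by (rule ascending_threshold) blast
    \<comment> \<open>Of \<open>a\<close> and \<open>a + 1\<close>, the one whose parity matches the
      arc between \<open>z\<close> and \<open>r\<close>, since \<open>p j\<close> dominates
      \<open>r\<close> exactly for even \<open>j\<close>. The only possible values off the path are
      0 and \<open>m + 1\<close>, and they make \<open>z\<close> uniform.\<close>
    define j where "j = (if even a = E z r then a else a + 1)"
    have ej: "E z r \<longleftrightarrow> even j" by (auto simp: j_def)
    have fj: "f i \<longleftrightarrow> j < i" if "i \<in> {1..m}" "i \<noteq> j" for i
      using a(2)[OF that(1)] that(2) by (auto simp: j_def split: if_splits)
    have "j \<notin> {1..m}" using not_p ej fj by blast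
    then consider "j = 0" | "j = m + 1" using a(1) by (auto simp: j_def split: if_splits)
    then show False
    proof cases
      case 1
      then have "f i" if "i \<in> {1..m}" for i using fj[OF that] that by auto
      moreover have "E z r" using ej 1 by simp
      ultimately have "uniform E K z" unfolding uniform_def f_def r(2) by blast
      then show False using notU by blast
    next
      case 2
      then have "\<not> f i" if "i \<in> {1..m}" for i using fj[OF that] that by auto
      moreover have "\<not> E z r" using ej 2 m by simp
      ultimately have "\<forall>x\<in>K. \<not> E z x" unfolding f_def r(2) by blast
      then have "uniform E K z" unfolding uniform_def using out by blast
      then show False using notU by blast
    qed
  qed
qed

end

section \<open>Isomorphic copies\<close>

lemma tourn_iso_sym:
  assumes "tourn_iso A E B E'"
  shows "tourn_iso B E' A E"
proof -
  obtain f where f: "bij_betw f A B" "\<forall>u\<in>A. \<forall>v\<in>A. E u v \<longleftrightarrow> E' (f u) (f v)"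
    using assms unfolding tourn_iso_def by blast
  show ?thesis
    by (rule tourn_iso_via[OF f(1) bij_betw_id, unfolded id_def]) (use f(2) in simp)
qed

lemma tourn_iso_trans:
  assumes "tourn_iso A E B E'" "tourn_iso B E' C E''"
  shows "tourn_iso A E C E''"
proof -
  obtain f where f: "bij_betw f A B" "\<forall>u\<in>A. \<forall>v\<in>A. E u v \<longleftrightarrow> E' (f u) (f v)"
    using assms(1) unfolding tourn_iso_def by blast
  obtain g where g: "bij_betw g B C" "\<forall>u\<in>B. \<forall>v\<in>B. E' u v \<longleftrightarrow> E'' (g u) (g v)"
    using assms(2) unfolding tourn_iso_def by blast
  have "f u \<in> B" if "u \<in> A" for u using f(1) that by (auto simp: bij_betw_def)
  then have "E u v \<longleftrightarrow> E'' ((g \<circ> f) u) ((g \<circ> f) v)" if "u \<in> A" "v \<in> A" for u v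
    using f(2) g(2) that by simp
  then show ?thesis using bij_betw_trans[OF f(1) g(1)] unfolding tourn_iso_def by blast
qed

lemma tourn_iso_refl: "tourn_iso A E A E"
  unfolding tourn_iso_def by (rule exI[of _ id]) simp

lemma tourn_iso_card: "tourn_iso A E B E' \<Longrightarrow> card A = card B"
  unfolding tourn_iso_def by (auto dest: bij_betw_same_card)

lemma tourn_iso_prime:
  assumes iso: "tourn_iso A E B E'" and pr: "prime_tournament A E"
  shows "prime_tournament B E'"
proof -
  obtain f where f: "bij_betw f A B" and e: "\<And>u v. u \<in> A \<Longrightarrow> v \<in> A \<Longrightarrow> E u v \<longleftrightarrow> E' (f u) (f v)"
    using iso unfolding tourn_iso_def by blast
  have inj: "inj_on f A" and B: "B = f ` A" using f by (auto simp: bij_betw_def)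
  have t: "tournament A E" using pr prime_tournamentD by blast
  have "tournament B E'"
    unfolding tournament_def B
  proof (intro conjI ballI impI)
    show "finite (f ` A)" "f ` A \<noteq> {}" using t unfolding tournament_def by auto
  next
    fix u assume "u \<in> f ` A"
    then show "\<not> E' u u" using e tournament_irrefl[OF t] by fast
  next
    fix u v assume "u \<in> f ` A" "v \<in> f ` A" "u \<noteq> v"
    then obtain a b where ab: "a \<in> A" "b \<in> A" "u = f a" "v = f b" "a \<noteq> b" by blast
    show "E' u v \<longleftrightarrow> \<not> E' v u"
      using e[OF ab(1,2)] e[OF ab(2,1)] tournamentD[OF t ab(1,2,5)] unfolding ab(3,4) by simp
  qed
  moreover have "\<not> nontrivial_set B Y" if Y: "homogeneous B E' Y" for Y
  proof -
    define X where "X = {a \<in> A. f a \<in> Y}"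
    have YX: "Y = f ` X" using Y unfolding homogeneous_def B X_def by blast
    have "X \<subseteq> A" by (auto simp: X_def)
    have "(\<forall>x\<in>X. E v x) \<or> (\<forall>x\<in>X. E x v)" if "v \<in> A - X" for v
    proof -
      have "f v \<in> B - Y" "v \<in> A" using that by (auto simp: X_def B)
      then have "(\<forall>y\<in>Y. E' (f v) y) \<or> (\<forall>y\<in>Y. E' y (f v))" using Y unfolding homogeneous_def by blast
      then show ?thesis using e \<open>v \<in> A\<close> unfolding X_def by blast
    qed
    then have "homogeneous A E X" using \<open>X \<subseteq> A\<close> unfolding homogeneous_def by blast
    then have "\<not> nontrivial_set A X" using pr unfolding prime_tournament_def by blast
    moreover have "card Y = card X" unfolding YX using inj \<open>X \<subseteq> A\<close> by (meson card_image inj_on_subset)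
    moreover have "card B = card A" unfolding B using inj by (rule card_image)
    ultimately show ?thesis unfolding nontrivial_set_def by simp
  qed
  ultimately show ?thesis unfolding prime_tournament_def by blast
qed

lemma tourn_iso_swap:
  assumes t: "tournament V E" and X: "X \<subseteq> V" and c: "c \<in> X" and z: "z \<in> V - X" and tw: "twins E X c z"
  shows "tourn_iso X E (insert z (X - {c})) E"
proof -
  let ?f = "id(c := z)"
  have "bij_betw ?f X (insert z (X - {c}))"
    unfolding bij_betw_def inj_on_def using c z by auto
  moreover have "E u v \<longleftrightarrow> E (?f u) (?f v)" if "u \<in> X" "v \<in> X" for u v
  proof -
    have *: "E v c \<longleftrightarrow> E v z" "E c v \<longleftrightarrow> E z v" if "v \<in> X" "v \<noteq> c" for v
    proof -
      have "v \<noteq> z" using that z by blast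
      then show "E v c \<longleftrightarrow> E v z" using twinsD[OF tw] that by simp
      then show "E c v \<longleftrightarrow> E z v"
        using tournamentD[OF t, of v c] tournamentD[OF t, of v z] that c z X \<open>v \<noteq> z\<close> by auto
    qed
    show ?thesis
      using *[of u] *[of v] that tournament_irrefl[OF t, of c] tournament_irrefl[OF t, of z] c z X
      by auto
  qed
  ultimately show ?thesis unfolding tourn_iso_def by blast
qed

section \<open>The named tournaments and the induction on the size of the copies\<close>

lemma (in stuck_pair) K_classified:
  "\<exists>k. odd k \<and> (tourn_iso K E {1..k} (T_edge k) \<or> tourn_iso K E {1..k} (U_edge k) \<or> tourn_iso K E {1..k} (W_edge k))"
proof -
  obtain p m ee oo where p: "good_path p m" and zz: "zigzag E p m ee oo" and
    cl: "K = p ` {1..m} \<and> odd m \<and> \<not> oo \<or>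
     (\<exists>r. r \<notin> p ` {1..m} \<and> K = insert r (p ` {1..m}) \<and> even m \<and> ee \<and> oo \<and>
        (\<forall>a\<in>{1..m}. E (p a) r \<longleftrightarrow> even a))"
    by (rule classification)
  have inj: "inj_on p {1..m}" using p unfolding good_path_def by (elim conjE)
  show ?thesis
    using cl
  proof
    assume a: "K = p ` {1..m} \<and> odd m \<and> \<not> oo"
    then have b: "bij_betw p {1..m} K" using inj by (simp add: bij_betw_def)
    show ?thesis
    proof (cases ee)
      case True
      then have "zigzag E p m True False" using zz a by simp
      then show ?thesis using zigzag_U[OF K_tournament b] a by blast
    next
      case False
      then have "zigzag E p m False False" using zz a by simp
      then show ?thesis using zigzag_T[OF K_tournament b] a by blast
    qed
  next
    assume "\<exists>r. r \<notin> p ` {1..m} \<and> K = insert r (p ` {1..m}) \<and> even m \<and> ee \<and> oo \<and>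
        (\<forall>a\<in>{1..m}. E (p a) r \<longleftrightarrow> even a)"
    then obtain r where r: "r \<notin> p ` {1..m}" "K = insert r (p ` {1..m})" and m: "even m" and eo: ee oo
      and er: "\<And>a. a \<in> {1..m} \<Longrightarrow> E (p a) r \<longleftrightarrow> even a" by blast
    have "K - {r} = p ` {1..m}" "r \<in> K" using r by auto
    then have b: "bij_betw p {1..m} (K - {r})" using inj by (simp add: bij_betw_def)
    have "zigzag E p m True True" using zz eo by simp
    from zigzag_W[OF K_tournament b \<open>r \<in> K\<close> m this er] show ?thesis using m by (intro exI[of _ "m + 1"]) simp
  qed
qed

text \<open>\<open>no_extension\<close> is the extension property at \<open>n + 2\<close>. When
  \<open>c\<close> is exchanged for a twin, a member of \<open>Q\<close> inside \<open>K\<close>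
  either avoids \<open>c\<close> and survives, or contains \<open>c\<close> and is exchanged
  itself.\<close>

lemma (in stuck) stuck_step:
  "stuck V E (n + 2) {K. K \<subseteq> V \<and> prime_tournament K E \<and> card K = n + 2 \<and> (\<exists>X\<in>Q. X \<subseteq> K)}"
proof (unfold_locales, goal_cases)
  case 1
  show ?case by (rule prime_V)
next
  case 2
  show ?case using n5 by simp
next
  case (3 X)
  then show ?case by simp
next
  case (4 X)
  then show ?case by simp
next
  case (5 X)
  then show ?case by simp
next
  case (6 K z)
  then interpret stuck_pair V E n Q K by unfold_locales auto
  show ?case using no_extension 6 by simp
next
  case (7 K c z)
  then have K: "K \<subseteq> V" "prime_tournament K E" "card K = n + 2" "\<exists>X\<in>Q. X \<subseteq> K" by auto
  let ?K = "insert z (K - {c})"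
  have iso: "tourn_iso K E ?K E" by (rule tourn_iso_swap[OF V_tournament K(1) 7(2-4)])
  obtain X where X: "X \<in> Q" "X \<subseteq> K" using K(4) by blast
  have "\<exists>Y\<in>Q. Y \<subseteq> ?K"
  proof (cases "c \<in> X")
    case True
    have "z \<in> V - X" using 7(3) X by blast
    from Q_swap[OF X(1) True this twins_subset[OF 7(4) X(2)]] have "insert z (X - {c}) \<in> Q" .
    moreover have "insert z (X - {c}) \<subseteq> ?K" using X(2) by auto
    ultimately show ?thesis by (rule rev_bexI)
  next
    case False
    then have "X \<subseteq> ?K" using X(2) by auto
    then show ?thesis using X(1) by (rule_tac x = X in bexI)
  qed
  moreover have "?K \<subseteq> V" using K 7 by blast
  ultimately show ?case
    using tourn_iso_prime[OF iso K(2)] tourn_iso_card[OF iso] K(3) by simp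
qed

text \<open>Induction on the room left in \<open>V\<close>: two vertices are added to
  \<open>X\<close>, and the result is either \<open>V\<close>, hence classified, or the starting set
  for \<open>n + 2\<close>.\<close>

lemma stuck_classified:
  assumes "stuck V E n Q" "X \<in> Q" "X \<noteq> V"
  shows "\<exists>k. odd k \<and> (tourn_iso V E {1..k} (T_edge k) \<or> tourn_iso V E {1..k} (U_edge k) \<or> tourn_iso V E {1..k} (W_edge k))"
  using assms
proof (induction "card V - n" arbitrary: n Q X rule: less_induct)
  case less
  interpret stuck V E n Q by (rule less.prems(1))
  have XV: "X \<subset> V" using Q_sub less.prems by blast
  have fin: "finite V" using V_tournament tournament_finite by blast
  have "3 \<le> card X" using Q_card[OF less.prems(2)] n5 by simp
  then obtain x y where xy: "x \<in> V - X" "y \<in> V - X" "x \<noteq> y" "prime_tournament (insert x (insert y X)) E"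
    using prime_two_extension[OF prime_V Q_prime[OF less.prems(2)] _ XV] Q_ext[OF less.prems(2)] by blast
  define K where "K = insert x (insert y X)"
  have K: "K \<subseteq> V" "prime_tournament K E" "X \<subseteq> K" using xy XV by (auto simp: K_def)
  have "finite X" using XV fin finite_subset by blast
  then have cK: "card K = n + 2" using xy Q_card[OF less.prems(2)] by (simp add: K_def)
  interpret stuck_pair V E n Q K
    using K cK less.prems(2) by unfold_locales auto
  show ?case
  proof (cases "K = V")
    case True
    then show ?thesis using K_classified by simp
  next
    case False
    have "n < card V" using cK K(1) card_mono[OF fin K(1)] by simp
    then have d: "card V - (n + 2) < card V - n" by simp
    show ?thesis
      by (rule less.hyps[OF d stuck_step _ False]) (use K cK less.prems(2) in auto)
  qed
qed

theorem theorem3p1: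
  fixes V :: "'a set" and E :: "'a \<Rightarrow> 'a \<Rightarrow> bool" and H :: "'a set"
  assumes "prime_tournament V E"
    and "\<forall>n. odd n \<longrightarrow> \<not> tourn_iso V E {1..n} (T_edge n)"
    and "\<forall>n. odd n \<longrightarrow> \<not> tourn_iso V E {1..n} (U_edge n)"
    and "\<forall>n. odd n \<longrightarrow> \<not> tourn_iso V E {1..n} (W_edge n)"
    and "H \<subseteq> V" and "prime_tournament H E"
    and "5 \<le> card H" and "card H \<le> card V - 1"
  shows "\<exists>S\<subseteq>V. card S = card H + 1 \<and> prime_tournament S E \<and>
           (\<exists>H'\<subseteq>S. tourn_iso H' E H E)"
proof (rule ccontr)
  assume n: "\<not> ?thesis"
  have t: "tournament V E" using assms(1) prime_tournamentD by blast
  \<comment> \<open>All copies of \<open>H\<close> in \<open>V\<close>; a prime extension of one of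
    them by one vertex would be the set \<open>S\<close> whose existence is denied.\<close>
  let ?Q = "{X. X \<subseteq> V \<and> tourn_iso X E H E}"
  have "stuck V E (card H) ?Q"
  proof (unfold_locales, goal_cases)
    case 1
    show ?case by (rule assms(1))
  next
    case 2
    show ?case by (rule assms(7))
  next
    case (3 X)
    then show ?case by simp
  next
    case (4 X)
    then show ?case using tourn_iso_card by blast
  next
    case (5 X)
    then show ?case using tourn_iso_prime[OF tourn_iso_sym assms(6)] by blast
  next
    case (6 X z)
    then have X: "X \<subseteq> V" "tourn_iso X E H E" "z \<in> V" "z \<notin> X" by auto
    have "finite X" using X(1) t tournament_finite finite_subset by blast
    then have c: "card (insert z X) = card H + 1" using X(4) tourn_iso_card[OF X(2)] by simp
    show ?case
    proof
      assume "prime_tournament (insert z X) E"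
      moreover have "insert z X \<subseteq> V" "X \<subseteq> insert z X" using X by auto
      ultimately show False using n c X(2) by blast
    qed
  next
    case (7 X c z)
    then have X: "X \<subseteq> V" "tourn_iso X E H E" by auto
    have "tourn_iso (insert z (X - {c})) E X E"
      using tourn_iso_swap[OF t X(1) 7(2-4)] by (rule tourn_iso_sym)
    then show ?case using tourn_iso_trans[OF _ X(2)] X(1) 7(3) by auto
  qed
  moreover have "H \<in> ?Q" using assms(5) tourn_iso_refl by blast
  moreover have "H \<noteq> V" using assms(7,8) by auto
  ultimately show False using stuck_classified assms(2-4) by blast
qed

end
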